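(* Let $C$ be a weighted oriented cycle. Then $\beta_{r,d}(R/I(C_{\mathrm{sink}}))=\beta_{r,d}(R/I(C_{\mathrm{iron}}))$ for all indices $r,d$. In particular, $\beta_r(R/I(C))=\beta_r(R/I(C_{\mathrm{sink}}))=\beta_r(R/I(C_{\mathrm{iron}}))$ for every index $r$.
   Context: A weighted oriented graph is a triple $\mathcal D=(V,E,\mathbf w)$ with $V$ a finite vertex set, $E$ a set of directed edges whose underlying undirected graph is simple, and $\mathbf w:V\to\mathbb N^+$. Over a field $\Bbbk$, with $R=\Bbbk[V]$ (standard grading), its edge ideal is $I(\mathcal D)=(xy^{\mathbf w(y)}\mid(x,y)\in E)$, where $(x,y)$ is the edge oriented from $x$ to $y$. $\beta_{r,d}$ and $\beta_r$ denote graded and total Betti numbers over $R$. A weighted oriented cycle $C$ has underlying graph a cycle on vertices $x_1,\dots,x_n$ with edges between $x_i$ and $x_{i+1}$, indices modulo $n$, with arbitrary orientations. A vertex is a sink if every edge incident to it is oriented towards it. $C_{\mathrm{sink}}$ is the weighted oriented cycle with the same oriented edges as $C$ and weights $\mathbf w_{\mathrm{sink}}(x_i)=1$ if $x_i$ is a sink, and $\mathbf w_{\mathrm{sink}}(x_i)=\mathbf w(x_i)$ otherwise. $C_{\mathrm{iron}}$ is the weighted oriented cycle on the same vertices obtained from $C_{\mathrm{sink}}$ by reversing each edge of the form $(x_i,x_{i-1})$, so that its edges are $(x_i,x_{i+1})$ for all $i$, with weights $\mathbf w_{\mathrm{iron}}(x_i)=\mathbf w_{\mathrm{sink}}(x_{i-1})$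 if $(x_i,x_{i-1})\in E(C_{\mathrm{sink}})$, and $\mathbf w_{\mathrm{iron}}(x_i)=\mathbf w_{\mathrm{sink}}(x_i)$ otherwise. *)

theory Defs
  imports
    "HOL-Library.Poly_Mapping"
    "HOL-Number_Theory.Cong"
    "Jordan_Normal_Form.Matrix_Kernel"
    "Jordan_Normal_Form.DL_Rank"
    "Jordan_Normal_Form.DL_Submatrix"
begin

section \<open>Weighted oriented graphs and cycles\<close>

text \<open>The vertex set is the whole (finite) type \<^typ>\<open>'v\<close>; an edge \<open>(u, v)\<close> is oriented from
  \<open>u\<close> to \<open>v\<close>.\<close>

record 'v wograph =
  edges :: "('v \<times> 'v) set"
  weight :: "'v \<Rightarrow> nat"

text \<open>Asymmetry of the edge relation says that the underlying undirected graph is simple: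
  no loops, and at most one oriented edge between two vertices.\<close>

definition weighted_oriented_graph :: "'v::finite wograph \<Rightarrow> bool" where
  "weighted_oriented_graph D \<longleftrightarrow> asym (edges D) \<and> (\<forall>v. 0 < weight D v)"

text \<open>The labelling \<open>x\<close> of the vertices is indexed by the integers modulo \<open>n\<close>.\<close>

definition weighted_oriented_cycle :: "nat \<Rightarrow> (int \<Rightarrow> 'v::finite) \<Rightarrow> 'v wograph \<Rightarrow> bool" where
  "weighted_oriented_cycle n x C \<longleftrightarrow>
     weighted_oriented_graph C \<and> 3 \<le> n \<and>
     surj x \<and> (\<forall>i j. x i = x j \<longleftrightarrow> [i = j] (mod int n)) \<and>
     (\<forall>u v. (u, v) \<in> edges C \<or> (v, u) \<in> edges C \<longleftrightarrow> (\<exists>i. {u, v} = {x i, x (i + 1)}))"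

definition is_sink :: "'v wograph \<Rightarrow> 'v \<Rightarrow> bool" where
  "is_sink D v \<longleftrightarrow> (\<forall>(s, t) \<in> edges D. v \<in> {s, t} \<longrightarrow> t = v)"

definition sink_cycle :: "'v wograph \<Rightarrow> 'v wograph" where
  "sink_cycle C = \<lparr>edges = edges C, weight = (\<lambda>v. if is_sink C v then 1 else weight C v)\<rparr>"

definition backward_edges :: "(int \<Rightarrow> 'v) \<Rightarrow> 'v wograph \<Rightarrow> ('v \<times> 'v) set" where
  "backward_edges x D = {e \<in> edges D. \<exists>i. e = (x i, x (i - 1))}"

text \<open>For a vertex \<open>v = x i\<close> of a cycle labelled by \<open>x\<close>, this is \<open>x (i - 1)\<close>; the choice of the
  index made by \<^const>\<open>inv_into\<close> is immaterial because \<open>x\<close> is periodic.\<close>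

definition cyc_pred :: "(int \<Rightarrow> 'v) \<Rightarrow> 'v \<Rightarrow> 'v" where
  "cyc_pred x v = x (inv_into UNIV x v - 1)"

definition iron_cycle :: "(int \<Rightarrow> 'v) \<Rightarrow> 'v wograph \<Rightarrow> 'v wograph" where
  "iron_cycle x C = (let S = sink_cycle C in
     \<lparr>edges = (edges S - backward_edges x S) \<union> (backward_edges x S)\<inverse>,
      weight = (\<lambda>v. if (v, cyc_pred x v) \<in> edges S then weight S (cyc_pred x v) else weight S v)\<rparr>)"

lemma cyc_pred_eq:
  assumes "weighted_oriented_cycle n x C"
  shows "cyc_pred x (x i) = x (i - 1)"
proof -
  have "x (inv_into UNIV x (x i)) = x i"
    by (simp add: f_inv_into_f)
  then have "[inv_into UNIV x (x i) = i] (mod int n)"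
    using assms by (simp add: weighted_oriented_cycle_def)
  then have "[inv_into UNIV x (x i) - 1 = i - 1] (mod int n)"
    by (intro cong_diff cong_refl)
  then show ?thesis
    using assms by (simp add: weighted_oriented_cycle_def cyc_pred_def)
qed

lemma edges_iron_cycle:
  assumes "weighted_oriented_cycle n x C"
  shows "edges (iron_cycle x C) = {(x i, x (i + 1)) | i. True}"
proof -
  define E where "E = edges C"
  define B where "B = backward_edges x C"
  have ae: "(u, v) \<in> E \<or> (v, u) \<in> E \<longleftrightarrow> (\<exists>i. {u, v} = {x i, x (i + 1)})" for u v
    using assms by (simp add: weighted_oriented_cycle_def E_def)
  have per: "x i = x j \<longleftrightarrow> [i = j] (mod int n)" for i j
    using assms by (simp add: weighted_oriented_cycle_def)
  have n: "3 \<le> n"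
    using assms by (simp add: weighted_oriented_cycle_def)
  have B: "B = {e \<in> E. \<exists>i. e = (x i, x (i - 1))}"
    by (simp add: B_def backward_edges_def E_def)
  have eq: "edges (iron_cycle x C) = (E - B) \<union> B\<inverse>"
    by (simp add: iron_cycle_def sink_cycle_def E_def B_def backward_edges_def Let_def)
  have nofb: "\<not> (x i = x j \<and> x (i + 1) = x (j - 1))" for i j
  proof
    assume "x i = x j \<and> x (i + 1) = x (j - 1)"
    then have "int n dvd (i - j)" "int n dvd (i + 1 - (j - 1))"
      by (auto simp: per cong_iff_dvd_diff)
    then have "int n dvd ((i + 1 - (j - 1)) - (i - j))"
      by (rule dvd_diff[rotated])
    then have "int n dvd 2" by simp
    then show False using n zdvd_imp_le[of "int n" 2] by simp
  qed
  show ?thesis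
  proof (rule Set.set_eqI, unfold split_paired_all)
    fix u v
    show "(u, v) \<in> edges (iron_cycle x C) \<longleftrightarrow> (u, v) \<in> {(x i, x (i + 1)) | i. True}" (is "?L \<longleftrightarrow> ?R")
    proof
      assume ?L
      then consider "(u, v) \<in> E" "(u, v) \<notin> B" | "(v, u) \<in> B" using eq by auto
      then show ?R
      proof cases
        case 1
        then obtain i where i: "{u, v} = {x i, x (i + 1)}" using ae[of u v] by auto
        have "\<not> (u = x (i + 1) \<and> v = x i)"
        proof
          assume "u = x (i + 1) \<and> v = x i"
          then have "(u, v) = (x (i + 1), x (i + 1 - 1))" by simp
          with 1 show False unfolding B mem_Collect_eq by metis
        qed
        with i have "u = x i \<and> v = x (i + 1)" by (auto simp: doubleton_eq_iff)
        then show ?thesis by auto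
      next
        case 2
        then obtain i where "v = x i" "u = x (i - 1)" unfolding B by auto
        then have "(u, v) = (x (i - 1), x ((i - 1) + 1))" by simp
        then show ?thesis unfolding mem_Collect_eq by metis
      qed
    next
      assume ?R
      then obtain i where i: "u = x i" "v = x (i + 1)" by auto
      then have "(u, v) \<in> E \<or> (v, u) \<in> E" using ae[of u v] by auto
      then show ?L
      proof
        assume "(u, v) \<in> E"
        moreover have "(u, v) \<notin> B" using i nofb unfolding B by auto
        ultimately show ?L using eq by simp
      next
        assume "(v, u) \<in> E"
        moreover have "(v, u) = (x (i + 1), x (i + 1 - 1))" using i by simp
        ultimately have "(v, u) \<in> B" unfolding B mem_Collect_eq by metis
        then show ?L using eq by simp
      qed
    qed
  qed
qed


section \<open>Edge ideals\<close>

text \<open>The polynomial ring over \<open>'k\<close> with one indeterminate per element of \<open>'v\<close>.\<close>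

type_synonym ('v, 'k) mpoly = "('v \<Rightarrow>\<^sub>0 nat) \<Rightarrow>\<^sub>0 'k"

definition var :: "'v \<Rightarrow> ('v, 'k::comm_ring_1) mpoly" where
  "var v = Poly_Mapping.single (Poly_Mapping.single v 1) 1"

text \<open>Spans in the ring regarded as a module over itself are the ideals generated by a set.\<close>

definition edge_ideal :: "'v wograph \<Rightarrow> ('v, 'k::comm_ring_1) mpoly set" where
  "edge_ideal D = module.span (*) {var s * var t ^ weight D t | s t. (s, t) \<in> edges D}"


section \<open>Graded Betti numbers of cyclic modules\<close>

definition mdeg :: "('v \<Rightarrow>\<^sub>0 nat) \<Rightarrow> nat" where
  "mdeg m = (\<Sum>v \<in> Poly_Mapping.keys m. Poly_Mapping.lookup m v)"

definition homogeneous :: "nat \<Rightarrow> ('v, 'k::zero) mpoly \<Rightarrow> bool" where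
  "homogeneous d p \<longleftrightarrow> (\<forall>m \<in> Poly_Mapping.keys p. mdeg m = d)"

text \<open>A sequence of graded free modules \<open>F\<^sub>r = \<Oplus>\<^sub>j R(- gens r ! j)\<close> of finite rank, that is, \<open>gens r\<close>
  lists the degrees of a basis of \<open>F\<^sub>r\<close>. The matrix \<open>diff r\<close> represents the map
  \<open>F\<^bsub>r+1\<^esub> \<rightarrow> F\<^sub>r\<close> (note the index shift), and \<open>aug\<close> lists representatives in \<open>R\<close> of the images
  of the basis of \<open>F\<^sub>0\<close> under the augmentation \<open>F\<^sub>0 \<rightarrow> R/I\<close>.\<close>

record (overloaded) ('v, 'k) free_complex =
  gens :: "nat \<Rightarrow> nat list"
  diff :: "nat \<Rightarrow> ('v, 'k) mpoly mat"
  aug :: "('v, 'k) mpoly vec"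

abbreviation rk :: "('v, 'k::zero, 'z) free_complex_scheme \<Rightarrow> nat \<Rightarrow> nat" where
  "rk F r \<equiv> length (gens F r)"

text \<open>The maps are homogeneous of degree \<open>0\<close>: a non-zero coefficient at a basis element of degree
  \<open>e\<close> in the image of a basis element of degree \<open>e'\<close> is homogeneous of degree \<open>e' - e\<close>.
  The last three conditions say that the augmentation is surjective, and that the sequence is
  exact at \<open>F\<^sub>0\<close> and at \<open>F\<^sub>r\<close> for \<open>r \<ge> 1\<close>.\<close>

definition graded_free_resolution ::
    "('v, 'k::field) free_complex \<Rightarrow> ('v, 'k) mpoly set \<Rightarrow> bool" where
  "graded_free_resolution F I \<longleftrightarrow>
     (\<forall>r. diff F r \<in> carrier_mat (rk F r) (rk F (Suc r))) \<and>
     aug F \<in> carrier_vec (rk F 0) \<and>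
     (\<forall>r. \<forall>i < rk F r. \<forall>j < rk F (Suc r). diff F r $$ (i, j) \<noteq> 0 \<longrightarrow>
        gens F r ! i \<le> gens F (Suc r) ! j \<and>
        homogeneous (gens F (Suc r) ! j - gens F r ! i) (diff F r $$ (i, j))) \<and>
     (\<forall>j < rk F 0. homogeneous (gens F 0 ! j) (aug F $ j)) \<and>
     (\<forall>p. \<exists>v \<in> carrier_vec (rk F 0). p - aug F \<bullet> v \<in> I) \<and>
     {v \<in> carrier_vec (rk F 0). aug F \<bullet> v \<in> I} =
       (\<lambda>u. diff F 0 *\<^sub>v u) ` carrier_vec (rk F 1) \<and>
     (\<forall>r. mat_kernel (diff F r) =
       (\<lambda>u. diff F (Suc r) *\<^sub>v u) ` carrier_vec (rk F (Suc (Suc r))))"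

text \<open>The differential \<open>F\<^sub>r \<otimes> k \<rightarrow> F\<^bsub>r-1\<^esub> \<otimes> k\<close>, where \<open>k\<close> is the residue field of \<open>R\<close> at the ideal
  generated by the indeterminates (so matrix entries are replaced by their constant terms), and
  \<open>F\<^bsub>-1\<^esub> = 0\<close>.\<close>

definition res_diff :: "('v, 'k::field) free_complex \<Rightarrow> nat \<Rightarrow> 'k mat" where
  "res_diff F r = (case r of 0 \<Rightarrow> 0\<^sub>m 0 (rk F 0)
     | Suc q \<Rightarrow> map_mat (\<lambda>p. Poly_Mapping.lookup p 0) (diff F q))"

text \<open>The degree \<open>d\<close> part of this differential: a basis of \<open>(F\<^sub>r \<otimes> k)\<^sub>d\<close> is given by the generators of
  \<open>F\<^sub>r\<close> of degree \<open>d\<close>.\<close>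

definition gens_of_degree :: "('v, 'k::zero) free_complex \<Rightarrow> nat \<Rightarrow> nat \<Rightarrow> nat set" where
  "gens_of_degree F r d = {j. j < rk F r \<and> gens F r ! j = d}"

definition graded_res_diff :: "('v, 'k::field) free_complex \<Rightarrow> nat \<Rightarrow> nat \<Rightarrow> 'k mat" where
  "graded_res_diff F r d =
     submatrix (res_diff F r) (gens_of_degree F (r - 1) d) (gens_of_degree F r d)"

text \<open>The dimension of \<open>ker A / im B\<close>, for matrices over a field with \<open>A B = 0\<close>.\<close>

definition homology_dim :: "'k::field mat \<Rightarrow> 'k mat \<Rightarrow> nat" where
  "homology_dim A B = kernel_dim A - vec_space.rank (dim_row B) B"

text \<open>For a homogeneous ideal \<open>I\<close>, the numbers \<open>dim\<^sub>k Tor\<^sub>r(R/I, k)\<^sub>d\<close> and \<open>dim\<^sub>k Tor\<^sub>r(R/I, k)\<close>,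
  computed, as in the definition of \<open>Tor\<close>, from some graded free resolution of \<open>R/I\<close>.\<close>

definition some_resolution :: "('v, 'k::field) mpoly set \<Rightarrow> ('v, 'k) free_complex" where
  "some_resolution I = (SOME F. graded_free_resolution F I)"

definition graded_betti :: "nat \<Rightarrow> nat \<Rightarrow> ('v, 'k::field) mpoly set \<Rightarrow> nat" where
  "graded_betti r d I = (let F = some_resolution I in
     homology_dim (graded_res_diff F r d) (graded_res_diff F (Suc r) d))"

definition total_betti :: "nat \<Rightarrow> ('v, 'k::field) mpoly set \<Rightarrow> nat" where
  "total_betti r I = (let F = some_resolution I in
     homology_dim (res_diff F r) (res_diff F (Suc r)))"

end

theory Submission
  imports Defs "HOL-Library.Function_Algebras"
begin

text \<open>Two monomial ideals whose generators are indexed by the same finite set have a Taylor complex with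
the same index sets: in homological degree \<open>r\<close> a free basis is given by the \<open>r\<close>-element sets \<open>s\<close> of
generators, placed in the degree of the least common multiple \<open>lcm s\<close>, and the coefficient of the face
\<open>t = s - {i}\<close> in the boundary of \<open>s\<close> is \<open>\<plusminus> lcm s / lcm t\<close>. After reduction modulo the indeterminates
this coefficient is \<open>\<plusminus> 1\<close> if \<open>lcm s = lcm t\<close> and \<open>0\<close> otherwise. The total Betti numbers therefore depend
only on the pairs of nested sets of generators with the same least common multiple. If \<open>t \<subseteq> s\<close>, then
\<open>lcm t\<close> divides \<open>lcm s\<close>, so the two are equal as soon as their degrees are; hence the function
\<open>s \<mapsto> deg (lcm s)\<close> determines the graded Betti numbers (\<open>betti_monomial_ideal_eq\<close>).

For the edge ideals of \<open>C\<^bsub>sink\<^esub>\<close> and of \<open>C\<^bsub>iron\<^esub>\<close> these functions coincide. In both ideals every vertex has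
exponent greater than \<open>1\<close> in at most one generator: two edges of \<open>C\<close> can only point to the same vertex if
it is a sink, and then it has weight \<open>1\<close> in \<open>C\<^bsub>sink\<^esub>\<close>; in \<open>C\<^bsub>iron\<^esub>\<close> every vertex is the head of exactly one edge.
Under this condition the degree of \<open>lcm s\<close> is the sum of the degrees of the generators in \<open>s\<close>, minus a
correction that only counts how many generators in \<open>s\<close> contain each vertex (\<open>mdeg_lcm_monom\<close>). The
generators of the two ideals that belong to the same edge contain the same vertices and have the same
degree. The edge ideal of \<open>C\<close> arises from that of \<open>C\<^bsub>sink\<^esub>\<close> by replacing each sink \<open>y\<close> by a power of \<open>y\<close>, which
changes degrees, but not which least common multiples coincide (\<open>lcm_monom_eq_iff_rescale\<close>).

Since the Betti numbers are defined by some graded free resolution, two further facts are needed.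
The Taylor complex is a resolution (\<open>taylor_resolution\<close>): in each multidegree it is the augmented chain
complex of the full simplex on the generators that divide this multidegree, which is contractible if there
is at least one such generator. And any two graded free resolutions of the same quotient give
the same numbers (\<open>betti_eq_resolution\<close>): they are homotopy equivalent by the comparison theorem, the
homotopy equivalence can be chosen homogeneous, and it induces isomorphisms on the homology of the
reduced complexes and of their parts in each degree.\<close>

section \<open>Dimensions of homology spaces of matrices\<close>

text \<open>Vectors of all lengths embed into the type of functions from the natural numbers, which is a vector
space in the type-class sense. Dimensions of subspaces can be compared there without keeping track of
carrier sets.\<close>

definition vec_fun :: "'k::zero vec \<Rightarrow> nat \<Rightarrow> 'k" where
  "vec_fun v = (\<lambda>i. if i < dim_vec v then v $ i else 0)"

interpretation fs: vector_space "\<lambda>(c::'k::field) (f::nat \<Rightarrow> 'k) i. c * f i"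
  by unfold_locales (auto simp: fun_eq_iff algebra_simps)

text \<open>A linear map that sends \<open>S\<close> to \<open>T\<close> and satisfies \<open>f -` W \<inter> S \<subseteq> U\<close> should be read as an injection from \<open>S / U\<close> to
\<open>T / W\<close>. Quotients are avoided: if \<open>E\<close> extends a basis of \<open>U\<close> to a basis of \<open>S\<close>, then a basis of \<open>W\<close>
together with \<open>f ` E\<close> is linearly independent in \<open>T\<close>.\<close>

lemma (in vector_space) dim_quotient_le:
  assumes lin: "Vector_Spaces.linear scale scale f"
    and sub: "subspace S" "subspace U" "subspace T" "subspace W" "U \<subseteq> S" "W \<subseteq> T"
    and fin: "finite Fs" "S \<subseteq> span Fs" "finite Ft" "T \<subseteq> span Ft"
    and fST: "\<And>v. v \<in> S \<Longrightarrow> f v \<in> T" and inj: "\<And>v. v \<in> S \<Longrightarrow> f v \<in> W \<Longrightarrow> v \<in> U"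
  shows "dim S - dim U \<le> dim T - dim W"
proof -
  interpret f: Vector_Spaces.linear scale scale f by (rule lin)
  obtain Bu where Bu: "Bu \<subseteq> U" "independent Bu" "U \<subseteq> span Bu" "card Bu = dim U"
    using basis_exists by blast
  obtain Bs where Bs: "Bu \<subseteq> Bs" "Bs \<subseteq> S" "independent Bs" "S \<subseteq> span Bs"
    using maximal_independent_subset_extend[of Bu S] Bu sub by blast
  obtain Bw where Bw: "Bw \<subseteq> W" "independent Bw" "W \<subseteq> span Bw" "card Bw = dim W"
    using basis_exists by blast
  have finBs: "finite Bs" using independent_span_bound[OF fin(1) Bs(3)] Bs fin by blast
  have finBw: "finite Bw" using independent_span_bound[OF fin(3) Bw(2)] Bw fin sub by blast
  define E where "E = Bs - Bu"
  have "independent (Bw \<union> f ` F) \<and> card (Bw \<union> f ` F) = card Bw + card F" if "finite F" "F \<subseteq> E" for F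
    using that
  proof (induction F)
    case empty
    then show ?case using Bw by simp
  next
    case (insert e F)
    then have IH: "independent (Bw \<union> f ` F)" "card (Bw \<union> f ` F) = card Bw + card F" by auto
    have eE: "e \<in> E" and FE: "F \<subseteq> E" using insert by auto
    have notin: "f e \<notin> span (Bw \<union> f ` F)"
    proof
      assume "f e \<in> span (Bw \<union> f ` F)"
      then obtain w z where wz: "f e = w + z" "w \<in> span Bw" "z \<in> span (f ` F)"
        unfolding span_Un by blast
      obtain s where s: "z = f s" "s \<in> span F" using wz f.span_image by auto
      have wW: "w \<in> W" using wz Bw sub by (meson span_minimal subsetD)
      have sS: "s \<in> S" using s FE Bs sub unfolding E_def by (meson Diff_subset span_minimal subset_iff)
      have eS: "e \<in> S" using eE Bs by (auto simp: E_def)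
      have "f (e - s) = w" using wz s by (simp add: f.diff)
      then have "e - s \<in> U" using inj[of "e - s"] wW sS eS sub by (simp add: subspace_diff)
      then have "e - s \<in> span (Bs - {e})"
        using Bu Bs eE span_mono[of Bu "Bs - {e}"] by (auto simp: E_def)
      moreover have "s \<in> span (Bs - {e})"
        using s span_mono[of F "Bs - {e}"] FE insert by (auto simp: E_def)
      ultimately have "e \<in> span (Bs - {e})" using span_add by fastforce
      then show False using Bs(3) eE unfolding dependent_def E_def by blast
    qed
    have "independent (insert (f e) (Bw \<union> f ` F))"
      by (rule independent_insertI[OF notin IH(1)])
    moreover have "f e \<notin> Bw \<union> f ` F" using notin span_base[of "f e" "Bw \<union> f ` F"] by auto
    ultimately show ?case using IH insert finBw by (simp add: card_insert_if)
  qed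
  from this[of E] have ind: "independent (Bw \<union> f ` E)" and c: "card (Bw \<union> f ` E) = card Bw + card E"
    using finBs by (auto simp: E_def)
  have "Bw \<union> f ` E \<subseteq> T" using Bw Bs sub fST by (auto simp: E_def)
  moreover obtain Bt where Bt: "Bt \<subseteq> T" "independent Bt" "T \<subseteq> span Bt" "card Bt = dim T"
    using basis_exists by blast
  moreover have "finite Bt" using independent_span_bound[OF fin(3) Bt(2)] Bt fin by blast
  ultimately have "card (Bw \<union> f ` E) \<le> dim T"
    using independent_span_bound[OF _ ind, of Bt] by (metis subset_trans)
  moreover have "card E = dim S - dim U"
    using Bu Bs finBs basis_card_eq_dim[of Bs S] finite_subset[OF Bs(1) finBs]
    by (simp add: E_def card_Diff_subset)
  ultimately show ?thesis using c Bw by simp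
qed

lemma vec_fun_inj: "inj_on vec_fun (carrier_vec n)"
proof (rule inj_onI)
  fix v w :: "'a vec" assume v: "v \<in> carrier_vec n" "w \<in> carrier_vec n" and eq: "vec_fun v = vec_fun w"
  show "v = w"
  proof (rule eq_vecI)
    fix i assume "i < dim_vec w"
    then show "v $ i = w $ i" using v fun_cong[OF eq, of i] by (simp add: vec_fun_def)
  qed (use v in simp)
qed

lemma vec_fun_sum:
  fixes w :: "'k::field vec"
  assumes "w \<in> carrier_vec n" "b \<subseteq> carrier_vec n"
    and "\<And>i. i < n \<Longrightarrow> w $ i = (\<Sum>v\<in>b. a v * v $ i)"
  shows "vec_fun w = (\<Sum>v\<in>b. (\<lambda>i. a v * vec_fun v i))"
proof
  fix i
  have eq: "(\<Sum>v\<in>b. (\<lambda>i. a v * vec_fun v i)) i = (\<Sum>v\<in>b. a v * vec_fun v i)"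
    by (induction b rule: infinite_finite_induct) auto
  have "vec_fun v i = (if i < n then v $ i else 0)" if "v \<in> b" for v
    using that assms by (auto simp: vec_fun_def)
  then have "(\<Sum>v\<in>b. a v * vec_fun v i) = (\<Sum>v\<in>b. a v * (if i < n then v $ i else 0))"
    by (intro sum.cong) auto
  then show "vec_fun w i = (\<Sum>v\<in>b. (\<lambda>i. a v * vec_fun v i)) i"
    using assms unfolding eq by (auto simp: vec_fun_def)
qed

text \<open>Transfers a basis between the two notions of vector space. Independence and spanning are phrased by
coordinates, because this is what the carrier-based theory provides for linear combinations.\<close>

lemma vec_fun_dim:
  fixes W :: "'k::field vec set"
  assumes b: "finite b" "b \<subseteq> W" "W \<subseteq> carrier_vec n"
    and span: "\<And>w. w \<in> W \<Longrightarrow> \<exists>a. \<forall>i<n. w $ i = (\<Sum>v\<in>b. a v * v $ i)"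
    and ind: "\<And>a v. (\<forall>i<n. (\<Sum>v\<in>b. a v * v $ i) = 0) \<Longrightarrow> v \<in> b \<Longrightarrow> a v = 0"
  shows "fs.dim (vec_fun ` W) = card b"
proof -
  have inj: "inj_on vec_fun b" using vec_fun_inj[of n] b by (meson inj_on_subset)
  have bn: "b \<subseteq> carrier_vec n" using b by auto
  have "fs.independent (vec_fun ` b)"
  proof (rule fs.independent_if_scalars_zero)
    show "finite (vec_fun ` b)" using b by simp
    fix f x assume s: "(\<Sum>x\<in>vec_fun ` b. (\<lambda>i. f x * x i)) = 0" and x: "x \<in> vec_fun ` b"
    then obtain v where v: "v \<in> b" "x = vec_fun v" by auto
    have "vec_fun (0\<^sub>v n) = (0 :: nat \<Rightarrow> 'k)" by (auto simp: vec_fun_def)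
    then have "(\<Sum>v\<in>b. (\<lambda>i. f (vec_fun v) * vec_fun v i)) = 0"
      using s by (simp add: sum.reindex[OF inj])
    then have 1: "(\<Sum>v\<in>b. (\<lambda>i. f (vec_fun v) * vec_fun v i)) i = 0" for i by simp
    have eq: "(\<Sum>v\<in>b. (\<lambda>i. f (vec_fun v) * vec_fun v i)) i = (\<Sum>v\<in>b. f (vec_fun v) * vec_fun v i)" for i
      using b(1) by (induction b) auto
    have "(\<Sum>v\<in>b. f (vec_fun v) * v $ i) = 0" if "i < n" for i
    proof -
      have "(\<Sum>v\<in>b. f (vec_fun v) * v $ i) = (\<Sum>v\<in>b. f (vec_fun v) * vec_fun v i)"
        using that bn by (intro sum.cong) (auto simp: vec_fun_def)
      then show ?thesis using 1 eq by simp
    qed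
    then show "f x = 0" using ind[of "\<lambda>v. f (vec_fun v)" v] v by auto
  qed
  moreover have "vec_fun ` W \<subseteq> fs.span (vec_fun ` b)"
  proof
    fix y assume "y \<in> vec_fun ` W"
    then obtain w where w: "w \<in> W" "y = vec_fun w" by auto
    obtain a where "\<forall>i<n. w $ i = (\<Sum>v\<in>b. a v * v $ i)" using span[OF w(1)] by auto
    then have "vec_fun w = (\<Sum>v\<in>b. (\<lambda>i. a v * vec_fun v i))"
      using w b by (intro vec_fun_sum[of _ n]) auto
    also have "\<dots> \<in> fs.span (vec_fun ` b)"
      by (intro fs.span_sum fs.span_scale fs.span_base) auto
    finally show "y \<in> fs.span (vec_fun ` b)" using w by simp
  qed
  ultimately have "card (vec_fun ` b) = fs.dim (vec_fun ` W)"
    using b by (intro fs.basis_card_eq_dim) auto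
  then show ?thesis using card_image[OF inj] by simp
qed

lemma kernel_dim_eq_dim:
  fixes A :: "'k::field mat"
  shows "kernel_dim A = fs.dim (vec_fun ` mat_kernel A)"
proof -
  define n where "n = dim_col A"
  interpret K: kernel "dim_row A" n A by unfold_locales (simp add: n_def)
  obtain B where B: "finite B" "K.basis B"
    using kernel_basis_exists[of A "dim_row A" n] by (auto simp: n_def)
  have Bs: "B \<subseteq> mat_kernel A" "K.Ker.span B = mat_kernel A" "\<not> K.lin_dep B"
    using B by (auto simp: K.Ker.basis_def)
  have car: "mat_kernel A \<subseteq> carrier_vec n" using mat_kernel_carrier[OF K.A] .
  have "fs.dim (vec_fun ` mat_kernel A) = card B"
  proof (rule vec_fun_dim[where n = n])
    fix w assume "w \<in> mat_kernel A"
    then have "w \<in> K.Ker.span B" using Bs by simp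
    then obtain a where a: "w = K.lincomb a B"
      using K.Ker.finite_in_span[OF B(1) Bs(1)] by blast
    then show "\<exists>a. \<forall>i<n. w $ i = (\<Sum>v\<in>B. a v * v $ i)"
      using K.lincomb_index[OF _ Bs(1)] by auto
  next
    fix a v assume z: "\<forall>i<n. (\<Sum>v\<in>B. a v * v $ i) = 0" and v: "v \<in> B"
    have "K.lincomb a B \<in> mat_kernel A" using Bs by (intro K.Ker.lincomb_closed) auto
    then have "K.lincomb a B \<in> carrier_vec n" using car by auto
    then have "K.lincomb a B = 0\<^sub>v n"
      using z K.lincomb_index[OF _ Bs(1)] by (intro eq_vecI) auto
    then have "\<not> (\<exists>v\<in>B. a v \<noteq> 0)" using Bs(3) B(1) unfolding K.Ker.lin_dep_def by auto
    then show "a v = 0" using v by auto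
  qed (use B Bs car in auto)
  then show ?thesis using K.Ker.dim_basis[OF B] by simp
qed

text \<open>The rank is the dimension of the column space, so a maximal independent set of columns is a basis of
the image.\<close>

lemma rank_eq_dim:
  fixes B :: "'k::field mat"
  assumes B: "B \<in> carrier_mat n p"
  shows "vec_space.rank n B = fs.dim (vec_fun ` ((\<lambda>u. B *\<^sub>v u) ` carrier_vec p))"
proof -
  interpret V: vec_space "TYPE('k)" n .
  obtain S where S: "maximal S (\<lambda>T. T \<subseteq> set (cols B) \<and> V.lin_indpt T)" 
  proof -
    have "\<exists>A. finite A \<and> maximal A (\<lambda>T. T \<subseteq> set (cols B) \<and> V.lin_indpt T) \<and> {} \<subseteq> A"
      by (rule maximal_exists_superset[of "set (cols B)"]) (auto simp: V.lin_dep_def)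
    then show ?thesis using that by blast
  qed
  then have S1: "S \<subseteq> set (cols B)" "V.lin_indpt S" by (auto simp: maximal_def)
  have bS: "finite S" "S \<subseteq> carrier_vec n" using S1 cols_dim[of B] B by (auto intro: finite_subset)
  have img: "B *\<^sub>v u \<in> V.span S" if u: "u \<in> carrier_vec p" for u
  proof -
    have "set (cols B) \<subseteq> V.span S"
    proof
      fix c assume c: "c \<in> set (cols B)"
      have cn: "c \<in> carrier_vec n" using c cols_dim[of B] B by auto
      show "c \<in> V.span S"
      proof (cases "c \<in> S")
        case True
        then show ?thesis using V.in_own_span[of S] bS by auto
      next
        case False
        then have "V.lin_dep (S \<union> {c})"
          using S c by (auto simp: maximal_def)
        then show ?thesis using V.lin_dep_iff_in_span[of S c] bS S1 cn False by auto
      qed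
    qed
    then have "V.span (set (cols B)) \<subseteq> V.span S"
      by (rule V.span_subsetI[OF bS(2)])
    moreover have "B *\<^sub>v u \<in> V.span (set (cols B))"
      using V.col_space_eq[OF B] B u unfolding V.col_space_def by auto
    ultimately show ?thesis by auto
  qed
  have "fs.dim (vec_fun ` ((\<lambda>u. B *\<^sub>v u) ` carrier_vec p)) = card S"
  proof (rule vec_fun_dim[where n = n])
    show "S \<subseteq> (\<lambda>u. B *\<^sub>v u) ` carrier_vec p"
    proof
      fix c assume "c \<in> S"
      then obtain j where j: "j < p" "c = col B j" using S1 B by (auto simp: cols_def)
      then have "c = B *\<^sub>v unit_vec p j" using B by (intro eq_vecI) (auto simp: scalar_prod_right_unit)
      then show "c \<in> (\<lambda>u. B *\<^sub>v u) ` carrier_vec p" by auto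
    qed
    fix w assume "w \<in> (\<lambda>u. B *\<^sub>v u) ` carrier_vec p"
    then have "w \<in> V.span S" using img by auto
    then obtain a where "w = V.lincomb a S"
      using V.finite_in_span[of S w] bS by auto
    then show "\<exists>a. \<forall>i<n. w $ i = (\<Sum>v\<in>S. a v * v $ i)"
      using V.lincomb_index[OF _ bS(2)] by auto
  next
    fix a v assume z: "\<forall>i<n. (\<Sum>v\<in>S. a v * v $ i) = 0" and v: "v \<in> S"
    have "V.lincomb a S = 0\<^sub>v n"
      using z V.lincomb_index[OF _ bS(2)] V.lincomb_dim[OF bS] by (intro eq_vecI) auto
    then show "a v = 0" using S1(2) bS(1) v unfolding V.lin_dep_def by auto
  qed (use B bS in auto)
  then show ?thesis using V.rank_card_indpt[OF B S] by simp
qed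

lemma vec_fun_add: "(v :: 'k::field vec) \<in> carrier_vec n \<Longrightarrow> w \<in> carrier_vec n \<Longrightarrow> vec_fun (v + w) = vec_fun v + vec_fun w"
  by (auto simp: vec_fun_def fun_eq_iff)

lemma vec_fun_smult: "vec_fun (c \<cdot>\<^sub>v v) = (\<lambda>i. (c::'k::field) * vec_fun v i)"
  by (auto simp: vec_fun_def fun_eq_iff)

lemma subspace_vec_fun:
  fixes W :: "'k::field vec set"
  assumes "W \<subseteq> carrier_vec n" "0\<^sub>v n \<in> W" "\<And>v w. v \<in> W \<Longrightarrow> w \<in> W \<Longrightarrow> v + w \<in> W"
    "\<And>c v. v \<in> W \<Longrightarrow> c \<cdot>\<^sub>v v \<in> W"
  shows "fs.subspace (vec_fun ` W)"
proof (rule fs.subspaceI)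
  have "vec_fun (0\<^sub>v n) = (0 :: nat \<Rightarrow> 'k)" by (auto simp: vec_fun_def)
  then show "0 \<in> vec_fun ` W" using assms(2) by (metis imageI)
next
  fix x y assume "x \<in> vec_fun ` W" "y \<in> vec_fun ` W"
  then obtain v w where "v \<in> W" "w \<in> W" "x = vec_fun v" "y = vec_fun w" by auto
  then show "x + y \<in> vec_fun ` W"
    using assms(1,3) vec_fun_add[of v n w] by (metis imageI subsetD)
next
  fix c x assume "x \<in> vec_fun ` W"
  then obtain v where "v \<in> W" "x = vec_fun v" by auto
  then show "(\<lambda>i. c * x i) \<in> vec_fun ` W"
    using assms(4) vec_fun_smult[of c v] by (metis imageI)
qed

definition mat_fun :: "'k::field mat \<Rightarrow> (nat \<Rightarrow> 'k) \<Rightarrow> nat \<Rightarrow> 'k" where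
  "mat_fun A x = (\<lambda>i. if i < dim_row A then \<Sum>j<dim_col A. A $$ (i, j) * x j else 0)"

lemma mat_fun_linear:
  "Vector_Spaces.linear (\<lambda>(c::'k::field) (f::nat \<Rightarrow> 'k) i. c * f i) (\<lambda>c f i. c * f i) (mat_fun A)"
  unfolding Vector_Spaces.linear_iff
  using fs.vector_space_axioms
  by (auto simp: mat_fun_def fun_eq_iff sum.distrib algebra_simps sum_distrib_left)

lemma mat_fun_vec_fun:
  assumes "A \<in> carrier_mat m n" "v \<in> carrier_vec n"
  shows "mat_fun A (vec_fun v) = vec_fun (A *\<^sub>v v)"
  using assms
  by (auto simp: mat_fun_def vec_fun_def fun_eq_iff scalar_prod_def lessThan_atLeast0 intro!: sum.cong)

lemma vec_fun_finite_span:
  "\<exists>F. finite F \<and> vec_fun ` carrier_vec n \<subseteq> fs.span (F :: (nat \<Rightarrow> 'k::field) set)"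
proof (intro exI conjI)
  let ?F = "(\<lambda>j. vec_fun (unit_vec n j) :: nat \<Rightarrow> 'k) ` {..<n}"
  show "finite ?F" by simp
  show "vec_fun ` carrier_vec n \<subseteq> fs.span ?F"
  proof
    fix x :: "nat \<Rightarrow> 'k" assume "x \<in> vec_fun ` carrier_vec n"
    then obtain v where v: "v \<in> carrier_vec n" "x = vec_fun v" by auto
    have eq: "(\<Sum>j\<in>J. (\<lambda>i. v $ j * vec_fun (unit_vec n j) i)) i
        = (\<Sum>j\<in>J. v $ j * vec_fun (unit_vec n j) i)" if "finite J" for J i
      using that by (induction J) auto
    have "x = (\<Sum>j<n. (\<lambda>i. v $ j * vec_fun (unit_vec n j) i))"
      unfolding fun_eq_iff eq[OF finite_lessThan] using v
      by (auto simp: vec_fun_def unit_vec_def if_distrib[of "\<lambda>x. _ * x"] cong: if_cong)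
    also have "\<dots> \<in> fs.span ?F"
      by (intro fs.span_sum fs.span_scale fs.span_base) auto
    finally show "x \<in> fs.span ?F" .
  qed
qed

lemma zero_mult_mat_vec: "u \<in> carrier_vec n \<Longrightarrow> 0\<^sub>m m n *\<^sub>v u = (0\<^sub>v m :: 'a::semiring_0 vec)"
  by (auto simp: scalar_prod_def intro!: eq_vecI)

text \<open>The matrices \<open>f\<close> and \<open>g\<close> of the hypotheses are the components of chain maps, and \<open>h\<close>, \<open>k\<close> those of
a homotopy from \<open>g f\<close> to the identity. If \<open>f v\<close> is a boundary, so is \<open>g f v\<close>, and by the homotopy so is
the cycle \<open>v\<close>; thus \<open>f\<close> is injective on homology.\<close>

lemma homology_dim_le:
  fixes A :: "'k::field mat"
  assumes A: "A \<in> carrier_mat m n" and B: "B \<in> carrier_mat n p" and AB: "A * B = 0\<^sub>m m p"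
    and A': "A' \<in> carrier_mat m' n'" and B': "B' \<in> carrier_mat n' p'" and AB': "A' * B' = 0\<^sub>m m' p'"
    and f: "f \<in> carrier_mat n' n" "f' \<in> carrier_mat m' m" "A' * f = f' * A"
    and g: "g \<in> carrier_mat n n'" "g' \<in> carrier_mat p p'" "g * B' = B * g'"
    and h: "h \<in> carrier_mat p n" "k \<in> carrier_mat n m" "1\<^sub>m n = g * f + (B * h + k * A)"
  shows "homology_dim A B \<le> homology_dim A' B'"
proof -
  let ?im = "\<lambda>(B::'k mat) p. (\<lambda>u. B *\<^sub>v u) ` carrier_vec p"
  have sub_ker: "fs.subspace (vec_fun ` mat_kernel (A::'k mat))" if A: "A \<in> carrier_mat m n" for A m n
    using A by (intro subspace_vec_fun[of _ n])
      (auto simp: mat_kernel[OF A] mult_add_distrib_mat_vec[OF A] mult_mat_vec[OF A])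
  have sub_im: "fs.subspace (vec_fun ` ?im B p)" if B: "B \<in> carrier_mat n p" for B n p
  proof (rule subspace_vec_fun[of _ n])
    show "0\<^sub>v n \<in> ?im B p" using B by (intro image_eqI[of _ _ "0\<^sub>v p"]) auto
    show "v + w \<in> ?im B p" if "v \<in> ?im B p" "w \<in> ?im B p" for v w
    proof -
      from that obtain a b where "a \<in> carrier_vec p" "b \<in> carrier_vec p" "v = B *\<^sub>v a" "w = B *\<^sub>v b"
        by auto
      then show ?thesis using mult_add_distrib_mat_vec[OF B, of a b]
        by (intro image_eqI[of _ _ "a + b"]) auto
    qed
    show "c \<cdot>\<^sub>v v \<in> ?im B p" if "v \<in> ?im B p" for c v
    proof -
      from that obtain a where "a \<in> carrier_vec p" "v = B *\<^sub>v a" by auto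
      then show ?thesis using mult_mat_vec[OF B, of a c]
        by (intro image_eqI[of _ _ "c \<cdot>\<^sub>v a"]) auto
    qed
  qed (use B in auto)
  have im_ker: "?im B p \<subseteq> mat_kernel A"
    if "A \<in> carrier_mat m n" "B \<in> carrier_mat n p" "A * B = 0\<^sub>m m p" for A B m n p
  proof -
    have "A *\<^sub>v (B *\<^sub>v u) = 0\<^sub>v m" if "u \<in> carrier_vec p" for u
      using assoc_mult_mat_vec[of A m n B p u, symmetric] zero_mult_mat_vec[of u p m]
        \<open>A \<in> _\<close> \<open>B \<in> _\<close> \<open>A * B = _\<close> that by simp
    then show ?thesis using that by (auto simp: mat_kernel)
  qed
  obtain F F' :: "(nat \<Rightarrow> 'k) set" where F: "finite F" "vec_fun ` carrier_vec n \<subseteq> fs.span F"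
    "finite F'" "vec_fun ` carrier_vec n' \<subseteq> fs.span F'"
    using vec_fun_finite_span[of n] vec_fun_finite_span[of n'] by blast
  have "fs.dim (vec_fun ` mat_kernel A) - fs.dim (vec_fun ` ?im B p)
      \<le> fs.dim (vec_fun ` mat_kernel A') - fs.dim (vec_fun ` ?im B' p')"
  proof (rule fs.dim_quotient_le[OF mat_fun_linear[of f]])
    show "vec_fun ` ?im B p \<subseteq> vec_fun ` mat_kernel A" "vec_fun ` ?im B' p' \<subseteq> vec_fun ` mat_kernel A'"
      using im_ker[OF A B AB] im_ker[OF A' B' AB'] by auto
    show "finite F" "finite F'" using F by auto
    show "vec_fun ` mat_kernel A \<subseteq> fs.span F" "vec_fun ` mat_kernel A' \<subseteq> fs.span F'"
      using F(2,4) mat_kernel_carrier[OF A] mat_kernel_carrier[OF A'] by (meson image_mono subset_trans)+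
    fix x assume "x \<in> vec_fun ` mat_kernel A"
    then obtain v where v: "v \<in> carrier_vec n" "A *\<^sub>v v = 0\<^sub>v m" "x = vec_fun v"
      by (auto simp: mat_kernel[OF A])
    have fx: "mat_fun f x = vec_fun (f *\<^sub>v v)" using mat_fun_vec_fun[OF f(1) v(1)] v by simp
    have "A' *\<^sub>v (f *\<^sub>v v) = (A' * f) *\<^sub>v v"
      by (rule assoc_mult_mat_vec[symmetric, OF A' f(1) v(1)])
    also have "\<dots> = f' *\<^sub>v (A *\<^sub>v v)"
      unfolding f(3) by (rule assoc_mult_mat_vec[OF f(2) A v(1)])
    also have "\<dots> = 0\<^sub>v m'" using f v by (auto intro!: eq_vecI)
    finally have "f *\<^sub>v v \<in> mat_kernel A'" using f v by (auto simp: mat_kernel[OF A'])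
    then show "mat_fun f x \<in> vec_fun ` mat_kernel A'" using fx by auto
    assume "mat_fun f x \<in> vec_fun ` ?im B' p'"
    then obtain u where u: "u \<in> carrier_vec p'" "vec_fun (f *\<^sub>v v) = vec_fun (B' *\<^sub>v u)"
      using fx by auto
    then have fv: "f *\<^sub>v v = B' *\<^sub>v u"
      using f v B' by (intro inj_onD[OF vec_fun_inj[of n']]) auto
    have "v = (g * f + (B * h + k * A)) *\<^sub>v v"
      unfolding h(3)[symmetric] using v by simp
    also have "\<dots> = (g * f) *\<^sub>v v + ((B * h) *\<^sub>v v + (k * A) *\<^sub>v v)"
      using A B f g h v by (simp add: add_mult_distrib_mat_vec[of _ n n])
    also have "(g * f) *\<^sub>v v = g *\<^sub>v (B' *\<^sub>v u)"
      using assoc_mult_mat_vec[OF g(1) f(1) v(1)] fv by simp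
    also have "\<dots> = (B * g') *\<^sub>v u" 
      unfolding g(3)[symmetric] by (rule assoc_mult_mat_vec[symmetric, OF g(1) B' u(1)])
    also have "\<dots> = B *\<^sub>v (g' *\<^sub>v u)" using g B u by simp
    also have "(B * h) *\<^sub>v v = B *\<^sub>v (h *\<^sub>v v)" using B h v by simp
    also have "(k * A) *\<^sub>v v = 0\<^sub>v n"
      using assoc_mult_mat_vec[OF h(2) A v(1)] v(2) h(2) by (auto intro!: eq_vecI)
    finally have "v = B *\<^sub>v (g' *\<^sub>v u + h *\<^sub>v v)"
      using B g h u v by (simp add: mult_add_distrib_mat_vec[OF B])
    moreover have "g' *\<^sub>v u + h *\<^sub>v v \<in> carrier_vec p" using g h u v by auto
    ultimately show "x \<in> vec_fun ` ?im B p" using v by auto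
  qed (use sub_ker[OF A] sub_ker[OF A'] sub_im[OF B] sub_im[OF B'] in auto)
  then show ?thesis
    using A B A' B' rank_eq_dim[OF B] rank_eq_dim[OF B']
    by (simp add: homology_dim_def kernel_dim_eq_dim)
qed

section \<open>Graded matrices\<close>

lemma mdeg_0 [simp]: "mdeg 0 = 0"
  by (simp add: mdeg_def)

lemma mdeg_add: "mdeg (m + m') = mdeg m + mdeg m'"
  unfolding mdeg_def by (rule setsum_keys_plus_distrib) auto

lemma homogeneous_mult:
  fixes p q :: "('v, 'k::semiring_0) mpoly"
  assumes "homogeneous d p" "homogeneous e q"
  shows "homogeneous (d + e) (p * q)"
  using assms keys_mult[of p q] unfolding homogeneous_def by (force simp: mdeg_add)

lemma homogeneous_0 [simp]: "homogeneous d 0"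
  by (simp add: homogeneous_def)

definition degree_part :: "nat \<Rightarrow> ('v, 'k::zero) mpoly \<Rightarrow> ('v, 'k) mpoly" where
  "degree_part d p = Abs_poly_mapping (\<lambda>m. if mdeg m = d then Poly_Mapping.lookup p m else 0)"

lemma lookup_degree_part [simp]:
  "Poly_Mapping.lookup (degree_part d p) m = (if mdeg m = d then Poly_Mapping.lookup p m else 0)"
proof -
  have "{m. (if mdeg m = d then Poly_Mapping.lookup p m else 0) \<noteq> 0} \<subseteq> {m. Poly_Mapping.lookup p m \<noteq> 0}"
    by auto
  then have "finite {m. (if mdeg m = d then Poly_Mapping.lookup p m else 0) \<noteq> 0}"
    using finite_lookup finite_subset by blast
  then show ?thesis by (simp add: degree_part_def)
qed

lemma homogeneous_degree_part: "homogeneous d (degree_part d p)"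
  by (auto simp: homogeneous_def in_keys_iff split: if_splits)

lemma degree_part_homogeneous: "homogeneous e p \<Longrightarrow> degree_part d p = (if d = e then p else 0)"
  by (rule poly_mapping_eqI) (auto simp: homogeneous_def in_keys_iff)

lemma degree_part_0 [simp]: "degree_part d 0 = 0"
  by (rule poly_mapping_eqI) auto

lemma degree_part_add: "degree_part d (p + q) = degree_part d p + degree_part d (q :: ('v, 'k::ab_group_add) mpoly)"
  by (rule poly_mapping_eqI) (auto simp: lookup_add)

lemma degree_part_minus: "degree_part d (p - q) = degree_part d p - degree_part d (q :: ('v, 'k::ab_group_add) mpoly)"
  by (rule poly_mapping_eqI) (auto simp: lookup_minus)

lemma degree_part_sum: "degree_part d (sum f A) = (\<Sum>a\<in>A. degree_part d (f a :: ('v, 'k::ab_group_add) mpoly))"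
  by (induction A rule: infinite_finite_induct) (auto simp: degree_part_add)

lemma poly_mapping_eq_sum_single:
  "p = (\<Sum>m\<in>Poly_Mapping.keys p. Poly_Mapping.single m (Poly_Mapping.lookup p m))"
proof (rule poly_mapping_eqI)
  fix k
  show "Poly_Mapping.lookup p k
      = Poly_Mapping.lookup (\<Sum>m\<in>Poly_Mapping.keys p. Poly_Mapping.single m (Poly_Mapping.lookup p m)) k"
    by (auto simp: lookup_sum lookup_single when_def in_keys_iff)
qed

lemma degree_part_mult:
  fixes p q :: "('v, 'k::comm_ring_1) mpoly"
  assumes q: "homogeneous e q"
  shows "degree_part d (q * p) = (if e \<le> d then q * degree_part (d - e) p else 0)"
proof -
  let ?s = "\<lambda>m. Poly_Mapping.single m (Poly_Mapping.lookup p m)"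
  have hs: "homogeneous (mdeg m) (?s m)" for m by (simp add: homogeneous_def)
  have "degree_part d (q * p) = (\<Sum>m\<in>Poly_Mapping.keys p. degree_part d (q * ?s m))"
    by (subst poly_mapping_eq_sum_single[of p]) (simp add: degree_part_sum sum_distrib_left)
  also have "\<dots> = (\<Sum>m\<in>Poly_Mapping.keys p. if e \<le> d then q * degree_part (d - e) (?s m) else 0)"
    by (intro sum.cong refl) (auto simp: degree_part_homogeneous[OF hs] degree_part_homogeneous[OF homogeneous_mult[OF q hs]])
  also have "\<dots> = (if e \<le> d then q * degree_part (d - e) (\<Sum>m\<in>Poly_Mapping.keys p. ?s m) else 0)"
    by (simp add: degree_part_sum sum_distrib_left)
  also have "(\<Sum>m\<in>Poly_Mapping.keys p. ?s m) = p"
    using poly_mapping_eq_sum_single[of p] by simp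
  finally show ?thesis .
qed

text \<open>The matrix of a degree-preserving map between graded free modules with basis elements of degrees \<open>b\<close>
(source) and \<open>a\<close> (target).\<close>

definition graded_mat :: "nat list \<Rightarrow> nat list \<Rightarrow> ('v, 'k::zero) mpoly mat \<Rightarrow> bool" where
  "graded_mat a b M \<longleftrightarrow> M \<in> carrier_mat (length a) (length b) \<and>
     (\<forall>i < length a. \<forall>j < length b. M $$ (i, j) \<noteq> 0 \<longrightarrow>
        a ! i \<le> b ! j \<and> homogeneous (b ! j - a ! i) (M $$ (i, j)))"

text \<open>The degree-preserving component of the map given by \<open>M\<close>.\<close>

definition graded_part :: "nat list \<Rightarrow> nat list \<Rightarrow> ('v, 'k::zero) mpoly mat \<Rightarrow> ('v, 'k) mpoly mat" where
  "graded_part a b M = mat (length a) (length b)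
     (\<lambda>(i, j). if a ! i \<le> b ! j then degree_part (b ! j - a ! i) (M $$ (i, j)) else 0)"

lemma graded_part_carrier [simp]: "graded_part a b M \<in> carrier_mat (length a) (length b)"
  by (simp add: graded_part_def)

lemma graded_mat_carrier: "graded_mat a b M \<Longrightarrow> M \<in> carrier_mat (length a) (length b)"
  by (simp add: graded_mat_def)

lemma graded_mat_graded_part: "graded_mat a b (graded_part a b M)"
  by (auto simp: graded_mat_def graded_part_def homogeneous_degree_part split: if_splits)

lemma graded_part_id: "graded_mat a b M \<Longrightarrow> graded_part a b M = M"
  unfolding graded_mat_def graded_part_def
  by (rule eq_matI) (auto, (metis degree_part_0 degree_part_homogeneous)+)

lemma graded_part_minus:
  fixes M N :: "('v, 'k::comm_ring_1) mpoly mat"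
  assumes "M \<in> carrier_mat (length a) (length b)" "N \<in> carrier_mat (length a) (length b)"
  shows "graded_part a b (M - N) = graded_part a b M - graded_part a b N"
  using assms by (intro eq_matI) (auto simp: graded_part_def degree_part_minus)

text \<open>This is what makes a lift homogeneous after the fact: if \<open>A Y = X\<close> with \<open>A\<close> and \<open>X\<close> homogeneous, then
the degree-preserving part of \<open>Y\<close> is a solution as well.\<close>

lemma graded_part_mult:
  fixes A M :: "('v, 'k::comm_ring_1) mpoly mat"
  assumes A: "graded_mat a b A" and M: "M \<in> carrier_mat (length b) (length c)"
  shows "graded_part a c (A * M) = A * graded_part b c M"
proof (rule eq_matI)
  have Ac: "A \<in> carrier_mat (length a) (length b)" using A by (rule graded_mat_carrier)
  fix i j assume "i < dim_row (A * graded_part b c M)" "j < dim_col (A * graded_part b c M)"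
  then have ij: "i < length a" "j < length c" using Ac by (auto simp: graded_part_def)
  have entry: "(A * N) $$ (i, j) = (\<Sum>k<length b. A $$ (i, k) * N $$ (k, j))"
    if "N \<in> carrier_mat (length b) (length c)" for N
    using Ac that ij by (auto simp: scalar_prod_def lessThan_atLeast0 intro!: sum.cong)
  have "(if a ! i \<le> c ! j then degree_part (c ! j - a ! i) (A $$ (i, k) * M $$ (k, j)) else 0)
      = A $$ (i, k) * (if b ! k \<le> c ! j then degree_part (c ! j - b ! k) (M $$ (k, j)) else 0)"
    if k: "k < length b" for k
  proof (cases "A $$ (i, k) = 0")
    case False
    then have *: "a ! i \<le> b ! k" "homogeneous (b ! k - a ! i) (A $$ (i, k))"
      using A ij k by (auto simp: graded_mat_def)
    then have "c ! j - a ! i - (b ! k - a ! i) = c ! j - b ! k"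
      "b ! k - a ! i \<le> c ! j - a ! i \<longleftrightarrow> b ! k \<le> c ! j" if "a ! i \<le> c ! j"
      using that by auto
    then show ?thesis using * by (auto simp: degree_part_mult)
  qed simp
  then have "(\<Sum>k<length b. if a ! i \<le> c ! j then degree_part (c ! j - a ! i) (A $$ (i, k) * M $$ (k, j)) else 0)
      = (\<Sum>k<length b. A $$ (i, k) * graded_part b c M $$ (k, j))"
    using ij by (intro sum.cong) (auto simp: graded_part_def)
  then show "graded_part a c (A * M) $$ (i, j) = (A * graded_part b c M) $$ (i, j)"
    using ij entry[OF M] entry[of "graded_part b c M"]
    by (auto simp: graded_part_def degree_part_sum)
qed (use A in \<open>auto simp: graded_part_def graded_mat_def\<close>)

lemma graded_mat_mult:
  fixes A B :: "('v, 'k::comm_ring_1) mpoly mat"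
  assumes "graded_mat a b A" "graded_mat b c B"
  shows "graded_mat a c (A * B)"
proof -
  have "graded_part a c (A * B) = A * B"
    using graded_part_mult[OF assms(1) graded_mat_carrier[OF assms(2)]] graded_part_id[OF assms(2)]
    by simp
  then show ?thesis using graded_mat_graded_part[of a c "A * B"] by simp
qed

lemma graded_mat_minus:
  fixes A B :: "('v, 'k::comm_ring_1) mpoly mat"
  assumes "graded_mat a b A" "graded_mat a b B"
  shows "graded_mat a b (A - B)"
proof -
  have "graded_part a b (A - B) = A - B"
    using assms by (simp add: graded_part_minus graded_mat_carrier graded_part_id)
  then show ?thesis using graded_mat_graded_part[of a b "A - B"] by simp
qed

lemma graded_mat_one: "graded_mat a a (1\<^sub>m (length a) :: ('v, 'k::comm_ring_1) mpoly mat)"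
  by (auto simp: graded_mat_def homogeneous_def)

lemma lift_columns:
  fixes B X :: "'a::comm_ring_1 mat"
  assumes B: "B \<in> carrier_mat n p" and X: "X \<in> carrier_mat n q"
    and cols: "\<And>j. j < q \<Longrightarrow> col X j \<in> (\<lambda>u. B *\<^sub>v u) ` carrier_vec p"
  shows "\<exists>Y \<in> carrier_mat p q. B * Y = X"
proof -
  obtain y where y: "\<And>j. j < q \<Longrightarrow> y j \<in> carrier_vec p \<and> col X j = B *\<^sub>v y j"
    using cols unfolding image_iff by metis
  define Y where "Y = mat p q (\<lambda>(i, j). y j $ i)"
  have "B * Y = X"
  proof (rule eq_matI)
    fix i j assume "i < dim_row X" "j < dim_col X"
    then have ij: "i < n" "j < q" using X by auto
    have "col Y j = y j" using y[OF ij(2)] ij by (intro eq_vecI) (auto simp: Y_def)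
    then have "(B * Y) $$ (i, j) = (B *\<^sub>v y j) $ i" using B ij by (simp add: Y_def)
    also have "\<dots> = col X j $ i" using y[OF ij(2)] by simp
    finally show "(B * Y) $$ (i, j) = X $$ (i, j)" using X ij by simp
  qed (use B X in \<open>auto simp: Y_def\<close>)
  then show ?thesis by (intro bexI[of _ Y]) (auto simp: Y_def)
qed

lemma graded_lift:
  fixes B X :: "('v, 'k::comm_ring_1) mpoly mat"
  assumes B: "graded_mat b c B" and X: "graded_mat b e X"
    and cols: "\<And>j. j < length e \<Longrightarrow> col X j \<in> (\<lambda>u. B *\<^sub>v u) ` carrier_vec (length c)"
  shows "\<exists>Y. graded_mat c e Y \<and> B * Y = X"
proof -
  obtain Y where Y: "Y \<in> carrier_mat (length c) (length e)" "B * Y = X"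
    using lift_columns[OF graded_mat_carrier[OF B] graded_mat_carrier[OF X] cols] by auto
  have "B * graded_part c e Y = X"
    using graded_part_mult[OF B Y(1)] Y(2) graded_part_id[OF X] by simp
  then show ?thesis using graded_mat_graded_part by blast
qed

section \<open>Comparison of resolutions\<close>

interpretation ideal: module "(*) :: 'a::comm_ring_1 \<Rightarrow> 'a \<Rightarrow> 'a"
  by unfold_locales (auto simp: algebra_simps)

definition homogeneous_ideal :: "('v, 'k::comm_ring_1) mpoly set \<Rightarrow> bool" where
  "homogeneous_ideal I \<longleftrightarrow> ideal.subspace I \<and> (\<forall>p \<in> I. \<forall>d. degree_part d p \<in> I)"

text \<open>In degree \<open>0\<close> the cycles are the kernel of the augmentation to \<open>R/I\<close>. With this convention exactness at
\<open>F\<^sub>0\<close> and at the other modules becomes the single statement \<open>cycles_eq\<close> below.\<close>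

definition cycles :: "('v, 'k::field) free_complex \<Rightarrow> ('v, 'k) mpoly set \<Rightarrow> nat \<Rightarrow> ('v, 'k) mpoly vec set" where
  "cycles F I r = (case r of 0 \<Rightarrow> {v \<in> carrier_vec (rk F 0). aug F \<bullet> v \<in> I} | Suc q \<Rightarrow> mat_kernel (diff F q))"

lemma mult_unit_vec: "M \<in> carrier_mat n p \<Longrightarrow> j < p \<Longrightarrow> M *\<^sub>v unit_vec p j = col (M :: 'a::comm_ring_1 mat) j"
  by (intro eq_vecI) (auto simp: scalar_prod_right_unit)

lemma mat_eq_zeroI:
  fixes M :: "'a::comm_ring_1 mat"
  assumes M: "M \<in> carrier_mat n p" and z: "\<And>u. u \<in> carrier_vec p \<Longrightarrow> M *\<^sub>v u = 0\<^sub>v n"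
  shows "M = 0\<^sub>m n p"
proof (rule eq_matI)
  fix i j assume "i < dim_row (0\<^sub>m n p :: 'a mat)" "j < dim_col (0\<^sub>m n p :: 'a mat)"
  then have ij: "i < n" "j < p" by auto
  then have "col M j = 0\<^sub>v n" using z[of "unit_vec p j"] mult_unit_vec[OF M] by simp
  then have "col M j $ i = 0" using ij by simp
  then show "M $$ (i, j) = 0\<^sub>m n p $$ (i, j)" using M ij by simp
qed (use M in auto)

context
  fixes F :: "('v, 'k::field) free_complex" and I :: "('v, 'k) mpoly set"
  assumes res: "graded_free_resolution F I"
begin

lemma diff_carrier: "diff F r \<in> carrier_mat (rk F r) (rk F (Suc r))"
  using res by (simp add: graded_free_resolution_def)

lemma diff_graded: "graded_mat (gens F r) (gens F (Suc r)) (diff F r)"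
  using res by (simp add: graded_free_resolution_def graded_mat_def)

lemma aug_carrier: "aug F \<in> carrier_vec (rk F 0)"
  using res by (simp add: graded_free_resolution_def)

lemma aug_graded: "graded_mat [0] (gens F 0) (mat_of_rows (rk F 0) [aug F])"
  using res aug_carrier
  by (auto simp: graded_free_resolution_def graded_mat_def mat_of_rows_def)

lemma cycles_eq: "cycles F I r = (\<lambda>u. diff F r *\<^sub>v u) ` carrier_vec (rk F (Suc r))"
  using res by (cases r) (simp_all add: graded_free_resolution_def cycles_def)

lemma cycles_0: "v \<in> cycles F I 0 \<longleftrightarrow> v \<in> carrier_vec (rk F 0) \<and> aug F \<bullet> v \<in> I"
  by (simp add: cycles_def)

lemma cycles_Suc: "v \<in> cycles F I (Suc r) \<longleftrightarrow> v \<in> carrier_vec (rk F (Suc r)) \<and> diff F r *\<^sub>v v = 0\<^sub>v (rk F r)"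
  using diff_carrier[of r] by (auto simp: cycles_def mat_kernel)

lemma diff_diff: "diff F r * diff F (Suc r) = 0\<^sub>m (rk F r) (rk F (Suc (Suc r)))"
proof (rule mat_eq_zeroI)
  fix u :: "('v, 'k) mpoly vec" assume u: "u \<in> carrier_vec (rk F (Suc (Suc r)))"
  then have "diff F (Suc r) *\<^sub>v u \<in> cycles F I (Suc r)" by (auto simp: cycles_eq)
  then show "(diff F r * diff F (Suc r)) *\<^sub>v u = 0\<^sub>v (rk F r)"
    using u assoc_mult_mat_vec[OF diff_carrier diff_carrier u] by (simp add: cycles_Suc)
qed (rule mult_carrier_mat[OF diff_carrier diff_carrier])

lemma graded_lift_cycles:
  assumes X: "graded_mat (gens F r) e X" and cols: "\<And>j. j < length e \<Longrightarrow> col X j \<in> cycles F I r"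
  shows "\<exists>Y. graded_mat (gens F (Suc r)) e Y \<and> diff F r * Y = X"
  using graded_lift[OF diff_graded X] cols by (simp add: cycles_eq)

text \<open>A chain map \<open>e\<close> from a free resolution to itself that induces \<open>0\<close> on \<open>R/I\<close> is homotopic to \<open>0\<close>. The
homotopy is constructed degree by degree: \<open>e (r+1) - h r \<circ> d\<close> takes values in cycles, because
\<open>(e r - d \<circ> h r) \<circ> d = 0\<close>, so it can be lifted through \<open>d\<close>. The last equation is carried along in the
induction.\<close>

lemma homotopy_to_zero:
  assumes I: "ideal.subspace I"
    and e: "\<And>r. graded_mat (gens F r) (gens F r) (e r)"
    and comm: "\<And>r. diff F r * e (Suc r) = e r * diff F r"
    and e0: "\<And>v. v \<in> carrier_vec (rk F 0) \<Longrightarrow> aug F \<bullet> (e 0 *\<^sub>v v) \<in> I"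
  shows "\<exists>h. (\<forall>r. graded_mat (gens F (Suc r)) (gens F r) (h r)) \<and> e 0 = diff F 0 * h 0 \<and>
    (\<forall>r. e (Suc r) = diff F (Suc r) * h (Suc r) + h r * diff F r)"
proof -
  note dc = diff_carrier and ec = graded_mat_carrier[OF e]
  define P where "P r H \<longleftrightarrow> graded_mat (gens F (Suc r)) (gens F r) H \<and>
      (e r - diff F r * H) * diff F r = 0\<^sub>m (rk F r) (rk F (Suc r)) \<and>
      (r = 0 \<longrightarrow> e 0 = diff F 0 * H)" for r H
  have "\<exists>h. \<forall>r. P r (h r) \<and> e (Suc r) = diff F (Suc r) * h (Suc r) + h r * diff F r"
  proof (rule dependent_nat_choice)
    have "col (e 0) j \<in> cycles F I 0" if "j < rk F 0" for j
      using e0[of "unit_vec (rk F 0) j"] mult_unit_vec[OF ec that] that ec[of 0]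
      by (simp add: cycles_0)
    then obtain H where H: "graded_mat (gens F (Suc 0)) (gens F 0) H" "diff F 0 * H = e 0"
      using graded_lift_cycles[OF e] by blast
    then show "\<exists>H. P 0 H"
      using dc[of 0] ec[of 0] unfolding P_def by (intro exI[of _ H]) auto
  next
    fix H r assume "P r H"
    then have H: "graded_mat (gens F (Suc r)) (gens F r) H"
      "(e r - diff F r * H) * diff F r = 0\<^sub>m (rk F r) (rk F (Suc r))"
      by (auto simp: P_def)
    then have Hc: "H \<in> carrier_mat (rk F (Suc r)) (rk F r)" by (auto dest: graded_mat_carrier)
    define X where "X = e (Suc r) - H * diff F r"
    have HD: "H * diff F r \<in> carrier_mat (rk F (Suc r)) (rk F (Suc r))" using Hc dc[of r] by simp
    have Xc: "X \<in> carrier_mat (rk F (Suc r)) (rk F (Suc r))" unfolding X_def by (rule minus_carrier_mat[OF HD])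
    have Xg: "graded_mat (gens F (Suc r)) (gens F (Suc r)) X"
      unfolding X_def using H by (intro graded_mat_minus e graded_mat_mult[OF _ diff_graded]) auto
    have "diff F r * X = diff F r * e (Suc r) - diff F r * (H * diff F r)"
      unfolding X_def by (rule mult_minus_distrib_mat[OF dc ec HD])
    also have "\<dots> = e r * diff F r - diff F r * H * diff F r"
      using comm assoc_mult_mat[OF dc Hc dc] by simp
    also have "\<dots> = (e r - diff F r * H) * diff F r"
      using minus_mult_distrib_mat[OF ec mult_carrier_mat[OF dc Hc] dc] by simp
    finally have DX: "diff F r * X = 0\<^sub>m (rk F r) (rk F (Suc r))" using H by simp
    have "col X j \<in> cycles F I (Suc r)" if j: "j < rk F (Suc r)" for j
    proof -
      have "diff F r *\<^sub>v col X j = col (diff F r * X) j"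
        using dc[of r] Xc j by (intro eq_vecI) auto
      then show ?thesis using DX Xc j by (simp add: cycles_Suc)
    qed
    then obtain K where K: "graded_mat (gens F (Suc (Suc r))) (gens F (Suc r)) K" "diff F (Suc r) * K = X"
      using graded_lift_cycles[OF Xg] by blast
    have Kc: "K \<in> carrier_mat (rk F (Suc (Suc r))) (rk F (Suc r))" using K(1) by (rule graded_mat_carrier)
    have eq: "e (Suc r) - diff F (Suc r) * K = H * diff F r"
      unfolding K X_def using ec[of "Suc r"] HD by (intro eq_matI) auto
    have "H * diff F r * diff F (Suc r) = 0\<^sub>m (rk F (Suc r)) (rk F (Suc (Suc r)))"
      using assoc_mult_mat[OF Hc dc dc] diff_diff Hc by simp
    moreover have "e (Suc r) = diff F (Suc r) * K + H * diff F r"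
      unfolding K X_def using ec[of "Suc r"] HD by (intro eq_matI) auto
    ultimately show "\<exists>K. P (Suc r) K \<and> e (Suc r) = diff F (Suc r) * K + H * diff F r"
      using K(1) eq unfolding P_def by auto
  qed
  then show ?thesis unfolding P_def by blast
qed

end

lemma mat_of_rows_mult:
  fixes u :: "'a::comm_ring_1 vec"
  assumes "u \<in> carrier_vec n" "M \<in> carrier_mat n p" "j < p"
  shows "(mat_of_rows n [u] * M) $$ (0, j) = u \<bullet> col M j"
  using assms by (simp add: mat_of_rows_def) (auto simp: scalar_prod_def intro!: sum.cong)

text \<open>The comparison theorem: the identity of \<open>R/I\<close> lifts to a homogeneous chain map. What makes the
recursion work is that each component maps cycles to cycles. Homogeneity of \<open>I\<close> is used for the first
component, where the equation only holds modulo \<open>I\<close>.\<close>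

lemma chain_map:
  fixes F G :: "('v, 'k::field) free_complex"
  assumes F: "graded_free_resolution F I" and G: "graded_free_resolution G I"
    and I: "homogeneous_ideal I"
  shows "\<exists>f. (\<forall>r. graded_mat (gens G r) (gens F r) (f r)) \<and>
    (\<forall>r. diff G r * f (Suc r) = f r * diff F r) \<and>
    (\<forall>v \<in> carrier_vec (rk F 0). aug F \<bullet> v - aug G \<bullet> (f 0 *\<^sub>v v) \<in> I)"
proof -
  have sub: "ideal.subspace I" using I by (simp add: homogeneous_ideal_def)
  note dF = diff_carrier[OF F] and dG = diff_carrier[OF G]
  define A where "A v w \<longleftrightarrow> aug F \<bullet> v - aug G \<bullet> w \<in> I" for v w
  define P where "P r f \<longleftrightarrow> graded_mat (gens G r) (gens F r) f \<and>
      (\<forall>v \<in> cycles F I r. f *\<^sub>v v \<in> cycles G I r) \<and>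
      (r = 0 \<longrightarrow> (\<forall>v \<in> carrier_vec (rk F 0). A v (f *\<^sub>v v)))" for r f
  have "\<exists>f. \<forall>r. P r (f r) \<and> diff G r * f (Suc r) = f r * diff F r"
  proof (rule dependent_nat_choice)
    have "\<exists>w \<in> carrier_vec (rk G 0). p - aug G \<bullet> w \<in> I" for p
      using G by (simp add: graded_free_resolution_def)
    then have "\<forall>j. \<exists>w. w \<in> carrier_vec (rk G 0) \<and> aug F $ j - aug G \<bullet> w \<in> I" by blast
    then obtain w where w: "\<And>j. w j \<in> carrier_vec (rk G 0) \<and> aug F $ j - aug G \<bullet> w j \<in> I"
      unfolding choice_iff by blast
    \<comment> \<open>The augmentation is treated as a matrix with one row of degree 0, so that the lemmas on graded matrices apply to it.\<close>
    define W where "W = mat (rk G 0) (rk F 0) (\<lambda>(i, j). w j $ i)"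
    have Wc: "W \<in> carrier_mat (rk G 0) (rk F 0)" by (simp add: W_def)
    have colW: "col W j = w j" if "j < rk F 0" for j
      using w[of j] that by (intro eq_vecI) (auto simp: W_def)
    define f where "f = graded_part (gens G 0) (gens F 0) W"
    have fg: "graded_mat (gens G 0) (gens F 0) f" by (simp add: f_def graded_mat_graded_part)
    note fc = graded_mat_carrier[OF fg]
    let ?aF = "mat_of_rows (rk F 0) [aug F]" and ?aG = "mat_of_rows (rk G 0) [aug G]"
    have aGW: "?aG * W \<in> carrier_mat (length [0::nat]) (rk F 0)"
      by (rule mult_carrier_mat[OF graded_mat_carrier[OF aug_graded[OF G]] Wc])
    have gp: "graded_part [0] (gens F 0) (?aF - ?aG * W) = ?aF - ?aG * f"
      unfolding f_def graded_part_mult[OF aug_graded[OF G] Wc, symmetric]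
        graded_part_minus[OF graded_mat_carrier[OF aug_graded[OF F]] aGW]
        graded_part_id[OF aug_graded[OF F]] ..
    have "(?aF - ?aG * f) $$ (0, j) = degree_part (gens F 0 ! j) ((?aF - ?aG * W) $$ (0, j))"
      if "j < rk F 0" for j
      unfolding gp[symmetric] using that by (simp add: graded_part_def)
    moreover have "(?aF - ?aG * X) $$ (0, j) = aug F $ j - aug G \<bullet> col X j"
      if "j < rk F 0" "X \<in> carrier_mat (rk G 0) (rk F 0)" for j X
      using that aug_carrier[OF F] mat_of_rows_mult[OF aug_carrier[OF G] that(2,1)]
      by (simp add: mat_of_rows_def)
    ultimately have colI: "aug F $ j - aug G \<bullet> col f j \<in> I" if "j < rk F 0" for j
      using that w[of j] Wc fc I colW[OF that] by (auto simp: homogeneous_ideal_def)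
    have Af: "A v (f *\<^sub>v v)" if v: "v \<in> carrier_vec (rk F 0)" for v
    proof -
      have "aug G \<bullet> (f *\<^sub>v v) = (\<Sum>i<rk G 0. \<Sum>j<rk F 0. aug G $ i * (f $$ (i, j) * v $ j))"
        using fc v by (auto simp: scalar_prod_def sum_distrib_left lessThan_atLeast0 intro!: sum.cong)
      also have "\<dots> = (\<Sum>j<rk F 0. \<Sum>i<rk G 0. aug G $ i * (f $$ (i, j) * v $ j))"
        by (rule sum.swap)
      also have "\<dots> = (\<Sum>j<rk F 0. v $ j * (aug G \<bullet> col f j))"
      proof (rule sum.cong[OF refl])
        fix j assume "j \<in> {..<rk F 0}"
        then have "aug G \<bullet> col f j = (\<Sum>i<rk G 0. aug G $ i * f $$ (i, j))"
          using fc by (simp add: scalar_prod_def lessThan_atLeast0)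
        then show "(\<Sum>i<rk G 0. aug G $ i * (f $$ (i, j) * v $ j)) = v $ j * (aug G \<bullet> col f j)"
          by (simp only: sum_distrib_left mult.assoc mult.commute[of "v $ j"])
      qed
      finally have Gv: "aug G \<bullet> (f *\<^sub>v v) = (\<Sum>j<rk F 0. v $ j * (aug G \<bullet> col f j))" .
      have "aug F \<bullet> v = (\<Sum>j<rk F 0. v $ j * aug F $ j)"
        using v by (auto simp: scalar_prod_def lessThan_atLeast0 intro!: sum.cong)
      then have "aug F \<bullet> v - aug G \<bullet> (f *\<^sub>v v)
          = (\<Sum>j<rk F 0. v $ j * (aug F $ j - aug G \<bullet> col f j))"
        unfolding Gv by (simp only: right_diff_distrib sum_subtractf)
      also have "\<dots> \<in> I"
        using colI by (intro ideal.subspace_sum[OF sub] ideal.subspace_scale[OF sub]) auto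
      finally show ?thesis by (simp add: A_def)
    qed
    have "f *\<^sub>v v \<in> cycles G I 0" if "v \<in> cycles F I 0" for v
    proof -
      have v: "v \<in> carrier_vec (rk F 0)" "aug F \<bullet> v \<in> I" using that by (auto simp: cycles_def)
      have "aug F \<bullet> v - (aug F \<bullet> v - aug G \<bullet> (f *\<^sub>v v)) \<in> I"
        by (rule ideal.subspace_diff[OF sub v(2) Af[OF v(1), unfolded A_def]])
      moreover have "aug F \<bullet> v - (aug F \<bullet> v - aug G \<bullet> (f *\<^sub>v v)) = aug G \<bullet> (f *\<^sub>v v)" by simp
      ultimately have "aug G \<bullet> (f *\<^sub>v v) \<in> I" by (rule back_subst[of "\<lambda>x. x \<in> I"])
      then show ?thesis using mult_mat_vec_carrier[OF fc v(1)] by (simp add: cycles_def)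
    qed
    then show "\<exists>f. P 0 f" using fg Af unfolding P_def by blast
  next
    fix f r assume P: "P r f"
    then have fg: "graded_mat (gens G r) (gens F r) f" by (simp add: P_def)
    note fc = graded_mat_carrier[OF fg]
    have "col (f * diff F r) j \<in> cycles G I r" if j: "j < rk F (Suc r)" for j
    proof -
      have "col (diff F r) j = diff F r *\<^sub>v unit_vec (rk F (Suc r)) j"
        using mult_unit_vec[OF dF j] by simp
      then have "col (diff F r) j \<in> cycles F I r" by (auto simp: cycles_eq[OF F])
      moreover have "col (f * diff F r) j = f *\<^sub>v col (diff F r) j"
        using fc dF[of r] j by (intro eq_vecI) auto
      ultimately show ?thesis using P by (simp add: P_def)
    qed
    then obtain f' where f': "graded_mat (gens G (Suc r)) (gens F (Suc r)) f'" "diff G r * f' = f * diff F r"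
      using graded_lift_cycles[OF G graded_mat_mult[OF fg diff_graded[OF F]]] by blast
    note fc' = graded_mat_carrier[OF f'(1)]
    have "f' *\<^sub>v v \<in> cycles G I (Suc r)" if "v \<in> cycles F I (Suc r)" for v
    proof -
      have v: "v \<in> carrier_vec (rk F (Suc r))" "diff F r *\<^sub>v v = 0\<^sub>v (rk F r)"
        using that by (auto simp: cycles_Suc[OF F])
      have "diff G r *\<^sub>v (f' *\<^sub>v v) = (diff G r * f') *\<^sub>v v"
        by (rule assoc_mult_mat_vec[OF dG fc' v(1), symmetric])
      also have "\<dots> = f *\<^sub>v (diff F r *\<^sub>v v)"
        unfolding f'(2) by (rule assoc_mult_mat_vec[OF fc dF v(1)])
      also have "\<dots> = 0\<^sub>v (rk G r)" using fc unfolding v(2) by (auto intro!: eq_vecI)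
      finally show ?thesis using fc' v by (simp add: cycles_Suc[OF G])
    qed
    then show "\<exists>f'. P (Suc r) f' \<and> diff G r * f' = f * diff F r"
      using f' unfolding P_def by blast
  qed
  then show ?thesis unfolding P_def A_def by blast
qed

lemma homotopy_equivalence:
  fixes F G :: "('v, 'k::field) free_complex"
  assumes F: "graded_free_resolution F I" and G: "graded_free_resolution G I"
    and I: "homogeneous_ideal I"
  shows "\<exists>f g h. (\<forall>r. graded_mat (gens G r) (gens F r) (f r)) \<and>
    (\<forall>r. diff G r * f (Suc r) = f r * diff F r) \<and>
    (\<forall>r. graded_mat (gens F r) (gens G r) (g r)) \<and>
    (\<forall>r. diff F r * g (Suc r) = g r * diff G r) \<and>
    (\<forall>r. graded_mat (gens F (Suc r)) (gens F r) (h r)) \<and>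
    1\<^sub>m (rk F 0) - g 0 * f 0 = diff F 0 * h 0 \<and>
    (\<forall>r. 1\<^sub>m (rk F (Suc r)) - g (Suc r) * f (Suc r) = diff F (Suc r) * h (Suc r) + h r * diff F r)"
proof -
  have sub: "ideal.subspace I" using I by (simp add: homogeneous_ideal_def)
  note dF = diff_carrier[OF F] and dG = diff_carrier[OF G]
  obtain f where f: "\<And>r. graded_mat (gens G r) (gens F r) (f r)"
    "\<And>r. diff G r * f (Suc r) = f r * diff F r"
    "\<And>v. v \<in> carrier_vec (rk F 0) \<Longrightarrow> aug F \<bullet> v - aug G \<bullet> (f 0 *\<^sub>v v) \<in> I"
    using chain_map[OF F G I] by blast
  obtain g where g: "\<And>r. graded_mat (gens F r) (gens G r) (g r)"
    "\<And>r. diff F r * g (Suc r) = g r * diff G r"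
    "\<And>v. v \<in> carrier_vec (rk G 0) \<Longrightarrow> aug G \<bullet> v - aug F \<bullet> (g 0 *\<^sub>v v) \<in> I"
    using chain_map[OF G F I] by blast
  note fc = graded_mat_carrier[OF f(1)] and gc = graded_mat_carrier[OF g(1)]
  define e where "e r = 1\<^sub>m (rk F r) - g r * f r" for r
  have gfc: "g r * f r \<in> carrier_mat (rk F r) (rk F r)" for r by (rule mult_carrier_mat[OF gc fc])
  have eg: "graded_mat (gens F r) (gens F r) (e r)" for r
    unfolding e_def by (intro graded_mat_minus graded_mat_one graded_mat_mult[OF g(1) f(1)])
  have comm: "diff F r * e (Suc r) = e r * diff F r" for r
  proof -
    have "diff F r * e (Suc r) = diff F r - diff F r * (g (Suc r) * f (Suc r))"
      using mult_minus_distrib_mat[OF dF one_carrier_mat gfc] dF[of r] by (simp add: e_def)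
    also have "diff F r * (g (Suc r) * f (Suc r)) = diff F r * g (Suc r) * f (Suc r)"
      by (rule assoc_mult_mat[OF dF gc fc, symmetric])
    also have "\<dots> = g r * (diff G r * f (Suc r))" unfolding g(2) by (rule assoc_mult_mat[OF gc dG fc])
    also have "\<dots> = g r * f r * diff F r" unfolding f(2) by (rule assoc_mult_mat[OF gc fc dF, symmetric])
    also have "diff F r - g r * f r * diff F r = e r * diff F r"
      using minus_mult_distrib_mat[OF one_carrier_mat gfc dF] dF[of r] by (simp add: e_def)
    finally show ?thesis .
  qed
  have e0: "aug F \<bullet> (e 0 *\<^sub>v v) \<in> I" if v: "v \<in> carrier_vec (rk F 0)" for v
  proof -
    have fv: "f 0 *\<^sub>v v \<in> carrier_vec (rk G 0)" by (rule mult_mat_vec_carrier[OF fc v])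
    have gfv: "g 0 *\<^sub>v (f 0 *\<^sub>v v) \<in> carrier_vec (rk F 0)" by (rule mult_mat_vec_carrier[OF gc fv])
    have "e 0 *\<^sub>v v = v - g 0 *\<^sub>v (f 0 *\<^sub>v v)"
      using minus_mult_distrib_mat_vec[OF one_carrier_mat gfc v] assoc_mult_mat_vec[OF gc fc v] v
      by (simp add: e_def)
    then have "aug F \<bullet> (e 0 *\<^sub>v v) = aug F \<bullet> v - aug F \<bullet> (g 0 *\<^sub>v (f 0 *\<^sub>v v))"
      using scalar_prod_minus_distrib[OF aug_carrier[OF F] v gfv] by simp
    also have "\<dots> = (aug F \<bullet> v - aug G \<bullet> (f 0 *\<^sub>v v)) + (aug G \<bullet> (f 0 *\<^sub>v v) - aug F \<bullet> (g 0 *\<^sub>v (f 0 *\<^sub>v v)))"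
      by simp
    also have "\<dots> \<in> I" by (rule ideal.subspace_add[OF sub f(3)[OF v] g(3)[OF fv]])
    finally show ?thesis .
  qed
  obtain h where "\<And>r. graded_mat (gens F (Suc r)) (gens F r) (h r)" "e 0 = diff F 0 * h 0"
    "\<And>r. e (Suc r) = diff F (Suc r) * h (Suc r) + h r * diff F r"
    using homotopy_to_zero[OF F sub eg comm e0] by blast
  then show ?thesis using f g unfolding e_def by blast
qed

section \<open>Reduction modulo the indeterminates\<close>

lemma lookup_mult_0:
  fixes p q :: "('v, 'k::comm_ring_1) mpoly"
  shows "Poly_Mapping.lookup (p * q) 0 = Poly_Mapping.lookup p 0 * Poly_Mapping.lookup q 0"
proof -
  have "0 = l + m \<longleftrightarrow> l = 0 \<and> m = 0" for l m :: "'v \<Rightarrow>\<^sub>0 nat"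
    by (auto simp: poly_mapping_eq_iff fun_eq_iff lookup_add)
  then have "(\<Sum>m. Poly_Mapping.lookup q m when 0 = l + m) = (Poly_Mapping.lookup q 0 when l = 0)"
    for l :: "'v \<Rightarrow>\<^sub>0 nat"
    by (cases "l = 0") auto
  then show ?thesis by (simp add: lookup_mult mult_when)
qed

text \<open>Taking constant terms is the ring homomorphism from \<open>R\<close> to its residue field \<open>k\<close>.\<close>

interpretation const_term: semiring_hom "\<lambda>p :: ('v, 'k::comm_ring_1) mpoly. Poly_Mapping.lookup p 0"
  by unfold_locales (simp_all add: lookup_add lookup_mult_0)

text \<open>Modulo the indeterminates, a homogeneous entry of positive degree vanishes. So a homogeneous matrix
becomes a block matrix that connects only basis elements of the same degree.\<close>

definition block_diagonal :: "nat list \<Rightarrow> nat list \<Rightarrow> 'k::zero mat \<Rightarrow> bool" where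
  "block_diagonal a b M \<longleftrightarrow> M \<in> carrier_mat (length a) (length b) \<and>
     (\<forall>i < length a. \<forall>j < length b. M $$ (i, j) \<noteq> 0 \<longrightarrow> a ! i = b ! j)"

abbreviation const_mat :: "('v, 'k::zero) mpoly mat \<Rightarrow> 'k mat" where
  "const_mat \<equiv> map_mat (\<lambda>p. Poly_Mapping.lookup p 0)"

lemma const_mat_add:
  fixes A B :: "('v, 'k::comm_ring_1) mpoly mat"
  assumes "A \<in> carrier_mat n p" "B \<in> carrier_mat n p"
  shows "const_mat (A + B) = const_mat A + const_mat B"
  using assms by (intro eq_matI) (auto simp: lookup_add)

lemma block_diagonal_const_mat:
  assumes "graded_mat a b M"
  shows "block_diagonal a b (const_mat M)"
  unfolding block_diagonal_def
proof (intro conjI allI impI)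
  show "const_mat M \<in> carrier_mat (length a) (length b)"
    using graded_mat_carrier[OF assms] by simp
  fix i j assume ij: "i < length a" "j < length b" "const_mat M $$ (i, j) \<noteq> 0"
  then have "Poly_Mapping.lookup (M $$ (i, j)) 0 \<noteq> 0" using graded_mat_carrier[OF assms] by simp
  then have "0 \<in> Poly_Mapping.keys (M $$ (i, j))" "M $$ (i, j) \<noteq> 0" by (auto simp: in_keys_iff)
  moreover have "a ! i \<le> b ! j \<and> homogeneous (b ! j - a ! i) (M $$ (i, j))"
    using assms ij calculation by (simp add: graded_mat_def)
  ultimately show "a ! i = b ! j" by (auto simp: homogeneous_def)
qed

text \<open>The degrees of the basis of \<open>F\<^bsub>r-1\<^esub>\<close>, where \<open>F\<^bsub>-1\<^esub> = 0\<close>.\<close>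

definition prev_gens :: "('v, 'k) free_complex \<Rightarrow> nat \<Rightarrow> nat list" where
  "prev_gens F r = (case r of 0 \<Rightarrow> [] | Suc q \<Rightarrow> gens F q)"

lemma res_diff_block_diagonal:
  fixes F :: "('v, 'k::field) free_complex"
  assumes "graded_free_resolution F I"
  shows "block_diagonal (prev_gens F r) (gens F r) (res_diff F r)"
  using block_diagonal_const_mat[OF diff_graded[OF assms]]
  by (cases r) (auto simp: prev_gens_def res_diff_def block_diagonal_def)

lemma res_diff_res_diff:
  fixes F :: "('v, 'k::field) free_complex"
  assumes F: "graded_free_resolution F I"
  shows "res_diff F r * res_diff F (Suc r) = 0\<^sub>m (length (prev_gens F r)) (rk F (Suc r))"
proof (cases r)
  case 0
  have "const_mat (diff F 0) \<in> carrier_mat (rk F 0) (rk F (Suc 0))"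
    using diff_carrier[OF F, of 0] by simp
  then show ?thesis using 0 by (intro eq_matI) (auto simp: res_diff_def prev_gens_def)
next
  case (Suc q)
  have "const_mat (diff F q) * const_mat (diff F (Suc q)) = const_mat (diff F q * diff F (Suc q))"
    by (rule const_term.mat_hom_mult[OF diff_carrier[OF F] diff_carrier[OF F], symmetric])
  also have "\<dots> = 0\<^sub>m (rk F q) (rk F (Suc (Suc q)))"
    unfolding diff_diff[OF F] by (intro eq_matI) auto
  finally show ?thesis using Suc by (simp add: res_diff_def prev_gens_def)
qed

text \<open>The homotopy equivalence between two resolutions, tensored with \<open>k\<close> and restricted to one homological
degree. For \<open>r = 0\<close> the module with index \<open>-1\<close> is \<open>0\<close>; its matrices have no rows or no columns.\<close>

lemma residue_homotopy_equivalence: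
  fixes F G :: "('v, 'k::field) free_complex"
  assumes F: "graded_free_resolution F I" and G: "graded_free_resolution G I"
    and I: "homogeneous_ideal I"
  shows "\<exists>f f' g g' h k.
    block_diagonal (gens G r) (gens F r) f \<and> block_diagonal (prev_gens G r) (prev_gens F r) f' \<and>
    res_diff G r * f = f' * res_diff F r \<and>
    block_diagonal (gens F r) (gens G r) g \<and> block_diagonal (gens F (Suc r)) (gens G (Suc r)) g' \<and>
    g * res_diff G (Suc r) = res_diff F (Suc r) * g' \<and>
    block_diagonal (gens F (Suc r)) (gens F r) h \<and> block_diagonal (gens F r) (prev_gens F r) k \<and>
    1\<^sub>m (rk F r) = g * f + (res_diff F (Suc r) * h + k * res_diff F r)"
proof -
  note dF = diff_carrier[OF F] and dG = diff_carrier[OF G]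
  obtain f g h where fgh: "\<And>r. graded_mat (gens G r) (gens F r) (f r)"
    "\<And>r. diff G r * f (Suc r) = f r * diff F r"
    "\<And>r. graded_mat (gens F r) (gens G r) (g r)"
    "\<And>r. diff F r * g (Suc r) = g r * diff G r"
    "\<And>r. graded_mat (gens F (Suc r)) (gens F r) (h r)"
    "1\<^sub>m (rk F 0) - g 0 * f 0 = diff F 0 * h 0"
    "\<And>r. 1\<^sub>m (rk F (Suc r)) - g (Suc r) * f (Suc r) = diff F (Suc r) * h (Suc r) + h r * diff F r"
    using homotopy_equivalence[OF F G I] by blast
  note fc = graded_mat_carrier[OF fgh(1)] and gc = graded_mat_carrier[OF fgh(3)]
    and hc = graded_mat_carrier[OF fgh(5)]
  note bd = block_diagonal_const_mat
  note hom_mult = const_term.mat_hom_mult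
  have gfc: "g r * f r \<in> carrier_mat (rk F r) (rk F r)" for r by (rule mult_carrier_mat[OF gc fc])
  have dhc: "diff F r * h r \<in> carrier_mat (rk F r) (rk F r)" for r by (rule mult_carrier_mat[OF dF hc])
  have hdc: "h r * diff F r \<in> carrier_mat (rk F (Suc r)) (rk F (Suc r))" for r
    by (rule mult_carrier_mat[OF hc dF])
  have gd: "const_mat (g r) * res_diff G (Suc r) = res_diff F (Suc r) * const_mat (g (Suc r))" for r
    using arg_cong[OF fgh(4)[of r], of const_mat] hom_mult[OF gc dG, of r] hom_mult[OF dF gc, of r]
    by (simp add: res_diff_def)
  show ?thesis
  proof (cases r)
    case 0
    let ?k = "0\<^sub>m (rk F 0) 0 :: 'k mat" and ?f' = "0\<^sub>m 0 0 :: 'k mat"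
    have eq: "1\<^sub>m (rk F 0) = g 0 * f 0 + diff F 0 * h 0"
      unfolding fgh(6)[symmetric] using gfc[of 0] by (intro eq_matI) auto
    have "1\<^sub>m (rk F 0) = const_mat (g 0 * f 0 + diff F 0 * h 0)"
      unfolding eq[symmetric] by (rule const_term.mat_hom_one[symmetric])
    also have "\<dots> = const_mat (g 0) * const_mat (f 0) + const_mat (diff F 0) * const_mat (h 0)"
      using hom_mult[OF gc fc, of 0] hom_mult[OF dF hc, of 0] gfc[of 0] dhc[of 0]
      by (simp add: const_mat_add[OF gfc dhc])
    also have "const_mat (diff F 0) * const_mat (h 0)
        = res_diff F (Suc 0) * const_mat (h 0) + ?k * res_diff F 0"
      using dF[of 0] hc[of 0] by (intro eq_matI) (auto simp: res_diff_def)
    finally have "1\<^sub>m (rk F 0) = const_mat (g 0) * const_mat (f 0) +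
      (res_diff F (Suc 0) * const_mat (h 0) + ?k * res_diff F 0)" .
    moreover have "res_diff G 0 * const_mat (f 0) = ?f' * res_diff F 0"
      using fc[of 0] by (intro eq_matI) (auto simp: res_diff_def)
    ultimately show ?thesis
      using 0 bd[OF fgh(1)[of 0]] bd[OF fgh(3)[of 0]] bd[OF fgh(3)[of 1]] bd[OF fgh(5)[of 0]] gd[of 0]
      by - (rule exI[of _ "const_mat (f 0)"], rule exI[of _ ?f'], rule exI[of _ "const_mat (g 0)"],
        rule exI[of _ "const_mat (g 1)"], rule exI[of _ "const_mat (h 0)"], rule exI[of _ ?k],
        simp add: block_diagonal_def prev_gens_def)
  next
    case (Suc q)
    have eq: "1\<^sub>m (rk F r) = g r * f r + (diff F r * h r + h q * diff F q)"
      unfolding Suc fgh(7)[symmetric] using gfc[of "Suc q"] by (intro eq_matI) auto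
    have "1\<^sub>m (rk F r) = const_mat (g r * f r + (diff F r * h r + h q * diff F q))"
      unfolding eq[symmetric] by (rule const_term.mat_hom_one[symmetric])
    also have "\<dots> = const_mat (g r) * const_mat (f r)
        + (const_mat (diff F r) * const_mat (h r) + const_mat (h q) * const_mat (diff F q))"
      using hom_mult[OF gc[of r] fc[of r]] hom_mult[OF dF[of r] hc[of r]] hom_mult[OF hc[of q] dF[of q]]
        const_mat_add[OF gfc[of "Suc q"] add_carrier_mat[OF hdc[of q], of "diff F (Suc q) * h (Suc q)"]]
        const_mat_add[OF dhc[of "Suc q"] hdc[of q]] Suc
      by simp
    finally have "1\<^sub>m (rk F r) = const_mat (g r) * const_mat (f r)
      + (res_diff F (Suc r) * const_mat (h r) + const_mat (h q) * res_diff F r)"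
      using Suc by (simp add: res_diff_def)
    moreover have "res_diff G r * const_mat (f r) = const_mat (f q) * res_diff F r"
      using Suc arg_cong[OF fgh(2)[of q], of const_mat] hom_mult[OF dG fc, of q] hom_mult[OF fc dF, of q]
      by (simp add: res_diff_def)
    ultimately show ?thesis
      using Suc bd[OF fgh(1)[of r]] bd[OF fgh(1)[of q]] bd[OF fgh(3)[of r]] bd[OF fgh(3)[of "Suc r"]]
        bd[OF fgh(5)[of r]] bd[OF fgh(5)[of q]] gd[of r]
      by - (rule exI[of _ "const_mat (f r)"], rule exI[of _ "const_mat (f q)"],
        rule exI[of _ "const_mat (g r)"], rule exI[of _ "const_mat (g (Suc r))"],
        rule exI[of _ "const_mat (h r)"], rule exI[of _ "const_mat (h q)"], simp add: prev_gens_def)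
  qed
qed

section \<open>Independence of the resolution\<close>

definition block :: "nat list \<Rightarrow> nat list \<Rightarrow> 'k mat \<Rightarrow> nat \<Rightarrow> 'k mat" where
  "block a b M d = submatrix M {i. i < length a \<and> a ! i = d} {j. j < length b \<and> b ! j = d}"

definition block_size :: "nat list \<Rightarrow> nat \<Rightarrow> nat" where
  "block_size a d = card {i. i < length a \<and> a ! i = d}"

definition block_index :: "nat list \<Rightarrow> nat \<Rightarrow> nat \<Rightarrow> nat" where
  "block_index a d i = pick {i. i < length a \<and> a ! i = d} i"

text \<open>The index translation behind \<^const>\<open>submatrix\<close>, as a bijection along which sums can be reindexed.\<close>

lemma block_index_bij: "bij_betw (block_index a d) {..<block_size a d} {i. i < length a \<and> a ! i = d}"
  (is "bij_betw _ _ ?S")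
proof -
  have inj: "inj_on (block_index a d) {..<block_size a d}"
    unfolding block_index_def block_size_def
    by (rule linorder_inj_onI) (use pick_mono[of _ ?S] in fastforce)+
  have "block_index a d ` {..<block_size a d} \<subseteq> ?S"
    using pick_in_set[of _ ?S] by (auto simp: block_index_def block_size_def)
  moreover have "card (block_index a d ` {..<block_size a d}) = card ?S"
    using card_image[OF inj] by (simp add: block_size_def)
  ultimately have "block_index a d ` {..<block_size a d} = ?S"
    by (intro card_subset_eq) auto
  with inj show ?thesis by (simp add: bij_betw_def)
qed

lemma block_index_in:
  assumes "i < block_size a d"
  shows "block_index a d i < length a" "a ! block_index a d i = d"
  using bij_betwE[OF block_index_bij[of a d]] assms by auto

lemma block_eq:
  assumes "M \<in> carrier_mat (length a) (length b)"
  shows "block a b M d = mat (block_size a d) (block_size b d)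
    (\<lambda>(i, j). M $$ (block_index a d i, block_index b d j))"
proof -
  have "{i. i < length a \<and> i < length a \<and> a ! i = d} = {i. i < length a \<and> a ! i = d}" for a :: "nat list"
    by auto
  then show ?thesis
    using assms by (simp add: block_def submatrix_def block_size_def block_index_def)
qed

lemma block_carrier:
  "M \<in> carrier_mat (length a) (length b) \<Longrightarrow> block a b M d \<in> carrier_mat (block_size a d) (block_size b d)"
  by (simp add: block_eq)

text \<open>If \<open>M\<close> is block diagonal, only summands with a middle index of degree \<open>d\<close> contribute to the
degree \<open>d\<close> block of \<open>M * N\<close>.\<close>

lemma block_mult:
  fixes M N :: "'k::semiring_0 mat"
  assumes M: "block_diagonal a b M" and N: "N \<in> carrier_mat (length b) (length c)"
  shows "block a c (M * N) d = block a b M d * block b c N d"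
proof -
  have Mc: "M \<in> carrier_mat (length a) (length b)" using M by (simp add: block_diagonal_def)
  have "(M * N) $$ (block_index a d i, block_index c d j)
      = (\<Sum>t<block_size b d. M $$ (block_index a d i, block_index b d t) * N $$ (block_index b d t, block_index c d j))"
    if i: "i < block_size a d" and j: "j < block_size c d" for i j
  proof -
    let ?i = "block_index a d i" and ?j = "block_index c d j"
    note ij = block_index_in[OF i] block_index_in[OF j]
    have "(M * N) $$ (?i, ?j) = (\<Sum>t<length b. M $$ (?i, t) * N $$ (t, ?j))"
      using ij Mc N by (auto simp: scalar_prod_def lessThan_atLeast0 intro!: sum.cong)
    also have "\<dots> = (\<Sum>t \<in> {t. t < length b \<and> b ! t = d}. M $$ (?i, t) * N $$ (t, ?j))"
    proof (rule sum.mono_neutral_right)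
      show "\<forall>t \<in> {..<length b} - {t. t < length b \<and> b ! t = d}. M $$ (?i, t) * N $$ (t, ?j) = 0"
      proof
        fix t assume "t \<in> {..<length b} - {t. t < length b \<and> b ! t = d}"
        then have "M $$ (?i, t) = 0" using M ij unfolding block_diagonal_def by force
        then show "M $$ (?i, t) * N $$ (t, ?j) = 0" by simp
      qed
    qed auto
    also have "\<dots> = (\<Sum>t<block_size b d. M $$ (?i, block_index b d t) * N $$ (block_index b d t, ?j))"
      by (rule sum.reindex_bij_betw[OF block_index_bij, symmetric])
    finally show ?thesis .
  qed
  then show ?thesis
    unfolding block_eq[OF mult_carrier_mat[OF Mc N]] block_eq[OF Mc] block_eq[OF N]
    by (intro eq_matI) (auto simp: scalar_prod_def lessThan_atLeast0)
qed

lemma block_add: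
  assumes "M \<in> carrier_mat (length a) (length b)" "N \<in> carrier_mat (length a) (length b)"
  shows "block a b (M + N) d = block a b M d + block a b N d"
  unfolding block_eq[OF assms(1)] block_eq[OF assms(2)] block_eq[OF add_carrier_mat[OF assms(2)]]
  using assms by (intro eq_matI) (auto simp: block_index_in)

lemma block_one: "block a a (1\<^sub>m (length a)) d = 1\<^sub>m (block_size a d)"
  unfolding block_eq[OF one_carrier_mat]
  using bij_betw_imp_inj_on[OF block_index_bij[of a d]]
  by (intro eq_matI) (auto simp: block_index_in inj_on_def)

lemma block_zero: "block a b (0\<^sub>m (length a) (length b)) d = 0\<^sub>m (block_size a d) (block_size b d)"
  unfolding block_eq[OF zero_carrier_mat] by (intro eq_matI) (auto simp: block_index_in)

lemma graded_res_diff_eq_block: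
  fixes F :: "('v, 'k::field) free_complex"
  assumes F: "graded_free_resolution F I"
  shows "graded_res_diff F r d = block (prev_gens F r) (gens F r) (res_diff F r) d"
proof (cases r)
  \<comment> \<open>Here the index set of the rows differs from the one of the block, but there are no rows.\<close>
  case 0
  then show ?thesis
    by (intro eq_matI) (auto simp: graded_res_diff_def block_def prev_gens_def res_diff_def
        dim_submatrix gens_of_degree_def)
next
  case (Suc q)
  then show ?thesis by (simp add: graded_res_diff_def block_def prev_gens_def gens_of_degree_def)
qed

text \<open>Injectivity on homology, for the reduced complexes and for their parts of degree \<open>d\<close>: the equations
between block diagonal matrices also hold between the blocks. Exchanging the two resolutions
turns the inequalities into equalities.\<close>

lemma homology_dim_resolutions_le:
  fixes F G :: "('v, 'k::field) free_complex"
  assumes F: "graded_free_resolution F I" and G: "graded_free_resolution G I"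
    and I: "homogeneous_ideal I"
  shows "homology_dim (res_diff F r) (res_diff F (Suc r)) \<le> homology_dim (res_diff G r) (res_diff G (Suc r))"
    and "homology_dim (graded_res_diff F r d) (graded_res_diff F (Suc r) d)
      \<le> homology_dim (graded_res_diff G r d) (graded_res_diff G (Suc r) d)"
proof -
  have pS: "prev_gens H (Suc r) = gens H r" for H :: "('v, 'k) free_complex"
    by (simp add: prev_gens_def)
  note A = res_diff_block_diagonal[OF F, of r] res_diff_block_diagonal[OF F, of "Suc r", unfolded pS]
    res_diff_block_diagonal[OF G, of r] res_diff_block_diagonal[OF G, of "Suc r", unfolded pS]
  obtain f f' g g' h k where *:
    "block_diagonal (gens G r) (gens F r) f" "block_diagonal (prev_gens G r) (prev_gens F r) f'"
    "res_diff G r * f = f' * res_diff F r"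
    "block_diagonal (gens F r) (gens G r) g" "block_diagonal (gens F (Suc r)) (gens G (Suc r)) g'"
    "g * res_diff G (Suc r) = res_diff F (Suc r) * g'"
    "block_diagonal (gens F (Suc r)) (gens F r) h" "block_diagonal (gens F r) (prev_gens F r) k"
    "1\<^sub>m (rk F r) = g * f + (res_diff F (Suc r) * h + k * res_diff F r)"
    using residue_homotopy_equivalence[OF F G I, of r] by blast
  have bc: "block_diagonal a b M \<Longrightarrow> M \<in> carrier_mat (length a) (length b)" for a b and M :: "'k mat"
    by (simp add: block_diagonal_def)
  note c = A[THEN bc] *(1,2,4,5,7,8)[THEN bc]
  show "homology_dim (res_diff F r) (res_diff F (Suc r)) \<le> homology_dim (res_diff G r) (res_diff G (Suc r))"
    by (rule homology_dim_le[OF c(1,2) res_diff_res_diff[OF F] c(3,4) res_diff_res_diff[OF G]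
          c(5,6) *(3) c(7,8) *(6) c(9,10) *(9)])
  let ?b = "\<lambda>a b M. block a b M d"
  note bl = block_carrier[where d = d]
  have 1: "?b (prev_gens H r) (gens H r) (res_diff H r) * ?b (gens H r) (gens H (Suc r)) (res_diff H (Suc r))
      = 0\<^sub>m (block_size (prev_gens H r) d) (block_size (gens H (Suc r)) d)"
    if H: "graded_free_resolution H I" for H
    using block_mult[OF res_diff_block_diagonal[OF H, of r] bc[OF res_diff_block_diagonal[OF H, of "Suc r"], unfolded pS], of d]
      res_diff_res_diff[OF H, of r] block_zero by metis
  have 2: "?b (prev_gens G r) (gens G r) (res_diff G r) * ?b (gens G r) (gens F r) f
      = ?b (prev_gens G r) (prev_gens F r) f' * ?b (prev_gens F r) (gens F r) (res_diff F r)"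
    using block_mult[OF A(3) c(5), of d] block_mult[OF *(2) c(1), of d] *(3) by simp
  have 3: "?b (gens F r) (gens G r) g * ?b (gens G r) (gens G (Suc r)) (res_diff G (Suc r))
      = ?b (gens F r) (gens F (Suc r)) (res_diff F (Suc r)) * ?b (gens F (Suc r)) (gens G (Suc r)) g'"
    using block_mult[OF *(4) c(4), of d] block_mult[OF A(2) c(8), of d] *(6) by simp
  have "?b (gens F r) (gens F r) (1\<^sub>m (rk F r)) = ?b (gens F r) (gens F r) (g * f)
      + (?b (gens F r) (gens F r) (res_diff F (Suc r) * h) + ?b (gens F r) (gens F r) (k * res_diff F r))"
    unfolding *(9)
    by (simp only: block_add[OF mult_carrier_mat[OF c(7,5)]
          add_carrier_mat[OF mult_carrier_mat[OF c(10,1)]]]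
        block_add[OF mult_carrier_mat[OF c(2,9)] mult_carrier_mat[OF c(10,1)]])
  then have 4: "1\<^sub>m (block_size (gens F r) d) = ?b (gens F r) (gens G r) g * ?b (gens G r) (gens F r) f
      + (?b (gens F r) (gens F (Suc r)) (res_diff F (Suc r)) * ?b (gens F (Suc r)) (gens F r) h
        + ?b (gens F r) (prev_gens F r) k * ?b (prev_gens F r) (gens F r) (res_diff F r))"
    unfolding block_one block_mult[OF *(4) c(5)] block_mult[OF A(2) c(9)] block_mult[OF *(8) c(1)] .
  show "homology_dim (graded_res_diff F r d) (graded_res_diff F (Suc r) d)
      \<le> homology_dim (graded_res_diff G r d) (graded_res_diff G (Suc r) d)"
    unfolding graded_res_diff_eq_block[OF F] graded_res_diff_eq_block[OF G] pS
    by (rule homology_dim_le[OF bl[OF c(1)] bl[OF c(2)] 1[OF F] bl[OF c(3)] bl[OF c(4)] 1[OF G]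
          bl[OF c(5)] bl[OF c(6)] 2 bl[OF c(7)] bl[OF c(8)] 3 bl[OF c(9)] bl[OF c(10)] 4])
qed

theorem betti_eq_resolution:
  fixes F :: "('v, 'k::field) free_complex"
  assumes F: "graded_free_resolution F I" and I: "homogeneous_ideal I"
  shows "graded_betti r d I = homology_dim (graded_res_diff F r d) (graded_res_diff F (Suc r) d)"
    and "total_betti r I = homology_dim (res_diff F r) (res_diff F (Suc r))"
proof -
  have S: "graded_free_resolution (some_resolution I) I"
    unfolding some_resolution_def by (rule someI[of _ F]) (rule F)
  show "graded_betti r d I = homology_dim (graded_res_diff F r d) (graded_res_diff F (Suc r) d)"
    using homology_dim_resolutions_le(2)[OF F S I, of r d] homology_dim_resolutions_le(2)[OF S F I, of r d]
    by (simp add: graded_betti_def Let_def)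
  show "total_betti r I = homology_dim (res_diff F r) (res_diff F (Suc r))"
    using homology_dim_resolutions_le(1)[OF F S I, of r] homology_dim_resolutions_le(1)[OF S F I, of r]
    by (simp add: total_betti_def Let_def)
qed

section \<open>Monomials\<close>

definition monom_dvd :: "('v \<Rightarrow>\<^sub>0 nat) \<Rightarrow> ('v \<Rightarrow>\<^sub>0 nat) \<Rightarrow> bool" (infix \<open>mdvd\<close> 50) where
  "a mdvd b \<longleftrightarrow> (\<forall>v. Poly_Mapping.lookup a v \<le> Poly_Mapping.lookup b v)"

lemma mdvd_refl [simp]: "a mdvd a"
  by (simp add: monom_dvd_def)

lemma mdvd_trans: "a mdvd b \<Longrightarrow> b mdvd c \<Longrightarrow> a mdvd c"
  unfolding monom_dvd_def using le_trans by blast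

lemma mdvd_add [simp]: "a mdvd b + a"
  by (simp add: monom_dvd_def lookup_add)

lemma mdvd_diff_add: "a mdvd b \<Longrightarrow> b - a + a = b"
  by (rule poly_mapping_eqI) (simp add: monom_dvd_def lookup_add lookup_minus)

lemma eq_add_iff_mdvd: "k = a + b \<longleftrightarrow> a mdvd k \<and> b = k - a"
  by (auto simp: monom_dvd_def poly_mapping_eq_iff fun_eq_iff lookup_add lookup_minus)

lemma mdeg_diff: "a mdvd b \<Longrightarrow> mdeg (b - a) = mdeg b - mdeg a"
  using mdeg_add[of "b - a" a] by (simp add: mdvd_diff_add)

lemma mdeg_mono: "a mdvd b \<Longrightarrow> mdeg a \<le> mdeg b"
  using mdeg_add[of "b - a" a] by (simp add: mdvd_diff_add)

lemma mdeg_eq_0_iff: "mdeg a = 0 \<longleftrightarrow> a = 0"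
  by (auto simp: mdeg_def in_keys_iff poly_mapping_eq_iff fun_eq_iff)

lemma mdvd_diff_eq_0_iff: "a mdvd b \<Longrightarrow> b - a = 0 \<longleftrightarrow> b = a"
  by (metis add_0 diff_self_eq_0 mdvd_diff_add cancel_comm_monoid_add_class.diff_cancel)

text \<open>This is why degrees of least common multiples suffice to recognise the constant entries of the Taylor
complex.\<close>

lemma mdvd_eq_iff_mdeg: "a mdvd b \<Longrightarrow> b = a \<longleftrightarrow> mdeg b = mdeg a"
  using mdeg_add[of "b - a" a] mdeg_eq_0_iff[of "b - a"] mdvd_diff_eq_0_iff[of a b]
  by (auto simp: mdvd_diff_add)

lemma lookup_single_mult:
  fixes q :: "('v, 'k::comm_ring_1) mpoly"
  shows "Poly_Mapping.lookup (Poly_Mapping.single a c * q) k = (if a mdvd k then c * Poly_Mapping.lookup q (k - a) else 0)"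
proof -
  have "(\<Sum>b. Poly_Mapping.lookup q b when k = a + b) = (if a mdvd k then Poly_Mapping.lookup q (k - a) else 0)"
    by (simp add: eq_add_iff_mdvd)
  then show ?thesis by (simp add: lookup_mult lookup_single when_mult)
qed

definition lcm_monom :: "(nat \<Rightarrow> 'v::finite \<Rightarrow>\<^sub>0 nat) \<Rightarrow> nat set \<Rightarrow> 'v \<Rightarrow>\<^sub>0 nat" where
  "lcm_monom m s = Abs_poly_mapping (\<lambda>v. Max (insert 0 ((\<lambda>i. Poly_Mapping.lookup (m i) v) ` s)))"

lemma lookup_lcm_monom:
  "Poly_Mapping.lookup (lcm_monom m s) v = Max (insert 0 ((\<lambda>i. Poly_Mapping.lookup (m i) v) ` s))"
  by (simp add: lcm_monom_def)

lemma lcm_monom_mdvd_iff: "finite s \<Longrightarrow> lcm_monom m s mdvd M \<longleftrightarrow> (\<forall>i\<in>s. m i mdvd M)"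
  by (auto simp: monom_dvd_def lookup_lcm_monom)

lemma lcm_monom_mono: "finite s \<Longrightarrow> t \<subseteq> s \<Longrightarrow> lcm_monom m t mdvd lcm_monom m s"
  using lcm_monom_mdvd_iff[of s m "lcm_monom m s"] by (auto simp: lcm_monom_mdvd_iff finite_subset)

lemma lcm_monom_empty [simp]: "lcm_monom m {} = 0"
  by (rule poly_mapping_eqI) (simp add: lookup_lcm_monom)

lemma lcm_monom_singleton [simp]: "lcm_monom m {i} = m i"
  by (rule poly_mapping_eqI) (simp add: lookup_lcm_monom)

section \<open>The simplicial chain complex of a full simplex\<close>

text \<open>The sign of the face \<open>t\<close> in the boundary of \<open>insert i t\<close>.\<close>

definition face_sign :: "nat \<Rightarrow> nat set \<Rightarrow> 'k::comm_ring_1" where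
  "face_sign i t = (- 1) ^ card {j \<in> t. j < i}"

text \<open>A chain is given by its coefficients \<open>w s\<close> for the faces \<open>s\<close> of all dimensions; the empty face is included,
so this is the augmented complex of the simplex with vertex set \<open>{..<N}\<close>.\<close>

definition simplex_boundary :: "nat \<Rightarrow> (nat set \<Rightarrow> 'k::comm_ring_1) \<Rightarrow> nat set \<Rightarrow> 'k" where
  "simplex_boundary N w t = (\<Sum>i \<in> {..<N} - t. face_sign i t * w (insert i t))"

text \<open>The contracting homotopy of a simplex: the cone over each face with apex \<open>i\<close>. There is no sign, because
the apex will be the least vertex.\<close>

definition cone_at :: "nat \<Rightarrow> (nat set \<Rightarrow> 'k::comm_ring_1) \<Rightarrow> nat set \<Rightarrow> 'k" where
  "cone_at i w s = (if i \<in> s then w (s - {i}) else 0)"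

lemma face_sign_insert:
  assumes "finite t" "i \<notin> t"
  shows "face_sign j (insert i t) = (if i < j then - face_sign j t else (face_sign j t :: 'k::comm_ring_1))"
proof (cases "i < j")
  case True
  then have "{l \<in> insert i t. l < j} = insert i {l \<in> t. l < j}" by auto
  then show ?thesis using True assms by (simp add: face_sign_def)
next
  case False
  then have "{l \<in> insert i t. l < j} = {l \<in> t. l < j}" by auto
  then show ?thesis using False by (simp add: face_sign_def)
qed

lemma face_sign_least: "(\<And>j. j \<in> t \<Longrightarrow> i \<le> j) \<Longrightarrow> face_sign i t = 1"
proof -
  assume "\<And>j. j \<in> t \<Longrightarrow> i \<le> j"
  then have "{j \<in> t. j < i} = {}" by force
  then show ?thesis unfolding face_sign_def by (simp only: card.empty power_0)
qed

text \<open>The coefficient of \<open>w (insert j (insert i t))\<close> for the ordered pair \<open>(i, j)\<close> is the negative of the one for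
\<open>(j, i)\<close>. The pairs with \<open>i < j\<close> are matched with those with \<open>j < i\<close>, which is valid in every characteristic.\<close>

lemma simplex_boundary_boundary:
  assumes t: "t \<subseteq> {..<N}"
  shows "simplex_boundary N (simplex_boundary N w) t = (0 :: 'k::comm_ring_1)"
proof -
  have fin: "finite t" using t finite_subset by blast
  define f :: "nat \<Rightarrow> nat \<Rightarrow> 'k" where
    "f i j = face_sign i t * face_sign j (insert i t) * w (insert j (insert i t))" for i j
  define U where "U = {..<N} - t"
  have anti: "f i j + f j i = 0" if "i \<in> U" "j \<in> U" "i < j" for i j
    using that fin by (simp add: f_def U_def face_sign_insert insert_commute)
  have "simplex_boundary N (simplex_boundary N w) t = (\<Sum>i\<in>U. \<Sum>j \<in> U - {i}. f i j)"
    unfolding simplex_boundary_def[of N _ t] U_def[symmetric]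
  proof (rule sum.cong[OF refl])
    fix i
    have U: "{..<N} - insert i t = U - {i}" by (auto simp: U_def)
    show "face_sign i t * simplex_boundary N w (insert i t) = (\<Sum>j \<in> U - {i}. f i j)"
      unfolding simplex_boundary_def f_def U sum_distrib_left mult.assoc ..
  qed
  also have "\<dots> = (\<Sum>i\<in>U. (\<Sum>j \<in> {j\<in>U. i < j}. f i j) + (\<Sum>j \<in> {j\<in>U. j < i}. f i j))"
  proof (rule sum.cong[OF refl])
    fix i assume "i \<in> U"
    have U: "U - {i} = {j\<in>U. i < j} \<union> {j\<in>U. j < i}" by auto
    show "(\<Sum>j \<in> U - {i}. f i j) = (\<Sum>j \<in> {j\<in>U. i < j}. f i j) + (\<Sum>j \<in> {j\<in>U. j < i}. f i j)"
      unfolding U by (rule sum.union_disjoint) (auto simp: U_def)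
  qed
  also have "\<dots> = (\<Sum>i\<in>U. \<Sum>j \<in> {j\<in>U. i < j}. f i j) + (\<Sum>i\<in>U. \<Sum>j \<in> {j\<in>U. j < i}. f i j)"
    by (rule sum.distrib)
  also have "(\<Sum>i\<in>U. \<Sum>j \<in> {j\<in>U. j < i}. f i j) = (\<Sum>j\<in>U. \<Sum>i \<in> {i\<in>U. j < i}. f i j)"
    by (rule sum.swap_restrict) (auto simp: U_def)
  also have "(\<Sum>i\<in>U. \<Sum>j \<in> {j\<in>U. i < j}. f i j) + (\<Sum>j\<in>U. \<Sum>i \<in> {i\<in>U. j < i}. f i j)
      = (\<Sum>i\<in>U. \<Sum>j \<in> {j\<in>U. i < j}. f i j + f j i)"
    by (simp add: sum.distrib)
  also have "\<dots> = 0" using anti by (intro sum.neutral ballI) auto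
  finally show ?thesis .
qed

text \<open>For chains on the simplex \<open>S\<close> the cone at its least vertex is a homotopy between the identity and \<open>0\<close>.\<close>

lemma simplex_boundary_cone:
  fixes w :: "nat set \<Rightarrow> 'k::comm_ring_1"
  assumes S: "S \<subseteq> {..<N}" "i0 \<in> S" "\<And>j. j \<in> S \<Longrightarrow> i0 \<le> j"
    and supp: "\<And>s. \<not> s \<subseteq> S \<Longrightarrow> w s = 0" and t: "t \<subseteq> {..<N}"
  shows "simplex_boundary N (cone_at i0 w) t = w t - cone_at i0 (simplex_boundary N w) t"
proof (cases "i0 \<in> t")
  case False
  have "simplex_boundary N (cone_at i0 w) t
      = (\<Sum>i \<in> {..<N} - t. if i = i0 then face_sign i0 t * w t else 0)"
    unfolding simplex_boundary_def using False by (intro sum.cong) (auto simp: cone_at_def)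
  also have "\<dots> = face_sign i0 t * w t"
    using S False by (simp add: subset_iff)
  also have "\<dots> = w t"
  proof (cases "t \<subseteq> S")
    case True
    then have "face_sign i0 t = (1::'k)" using S(3) by (intro face_sign_least) auto
    then show ?thesis by simp
  qed (use supp in simp)
  finally show ?thesis using False by (simp add: cone_at_def)
next
  case True
  define t' where "t' = t - {i0}"
  have t': "finite t'" "i0 \<notin> t'" "t = insert i0 t'"
    using t True by (auto simp: t'_def finite_subset)
  have U: "{..<N} - t' = insert i0 ({..<N} - t)" using S t' by auto
  have "simplex_boundary N (cone_at i0 w) t = (\<Sum>i \<in> {..<N} - t. face_sign i t * w (insert i t'))"
    unfolding simplex_boundary_def using True
    by (intro sum.cong refl) (auto simp: cone_at_def t'_def insert_Diff_if)
  also have "\<dots> = (\<Sum>i \<in> {..<N} - t. - (face_sign i t' * w (insert i t')))"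
  proof (rule sum.cong[OF refl])
    fix i assume i: "i \<in> {..<N} - t"
    show "face_sign i t * w (insert i t') = - (face_sign i t' * w (insert i t'))"
    proof (cases "i \<in> S")
      case True
      then have "i0 < i" using S(3) i t' by (metis DiffD2 insertI1 le_neq_implies_less)
      then show ?thesis using t' by (simp add: face_sign_insert)
    next
      case False
      then show ?thesis using supp by simp
    qed
  qed
  also have "\<dots> = - (\<Sum>i \<in> {..<N} - t. face_sign i t' * w (insert i t'))"
    by (rule sum_negf)
  finally have 1: "simplex_boundary N (cone_at i0 w) t
      = - (\<Sum>i \<in> {..<N} - t. face_sign i t' * w (insert i t'))" .
  have "face_sign i0 t' * w t = w t"
  proof (cases "t \<subseteq> S")
    case True
    then have "face_sign i0 t' = (1::'k)" using S(3) t' by (intro face_sign_least) auto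
    then show ?thesis by simp
  qed (use supp in simp)
  then have "simplex_boundary N w t' = w t + (\<Sum>i \<in> {..<N} - t. face_sign i t' * w (insert i t'))"
    unfolding simplex_boundary_def U using True t' by (subst sum.insert) auto
  then show ?thesis using 1 True by (simp add: cone_at_def t'_def)
qed

section \<open>The Taylor complex\<close>

text \<open>A chain \<open>\<Sum> v s e\<^sub>s\<close>, where the basis element \<open>e\<^sub>s\<close> has multidegree \<open>lcm s\<close>, is a sum of terms
\<open>c x\<^sup>a e\<^sub>s\<close> of multidegree \<open>x\<^sup>a lcm s\<close>. This is the coefficient \<open>c\<close> of the term at \<open>e\<^sub>s\<close> of multidegree \<open>M\<close>.\<close>

definition multidegree_coeff ::
    "(nat \<Rightarrow> 'v::finite \<Rightarrow>\<^sub>0 nat) \<Rightarrow> ('v \<Rightarrow>\<^sub>0 nat) \<Rightarrow> (nat set \<Rightarrow> ('v, 'k::comm_ring_1) mpoly) \<Rightarrow> nat set \<Rightarrow> 'k" where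
  "multidegree_coeff m M v s =
     (if lcm_monom m s mdvd M then Poly_Mapping.lookup (v s) (M - lcm_monom m s) else 0)"

text \<open>The boundary map of the Taylor complex, in terms of the coefficients of a chain \<open>\<Sum> v s e\<^sub>s\<close>.\<close>

definition taylor_boundary ::
    "(nat \<Rightarrow> 'v::finite \<Rightarrow>\<^sub>0 nat) \<Rightarrow> nat \<Rightarrow> (nat set \<Rightarrow> ('v, 'k::comm_ring_1) mpoly) \<Rightarrow> nat set \<Rightarrow> ('v, 'k) mpoly" where
  "taylor_boundary m N v t = (\<Sum>i \<in> {..<N} - t.
     Poly_Mapping.single (lcm_monom m (insert i t) - lcm_monom m t) (face_sign i t) * v (insert i t))"

lemma multidegree_coeff_eqI:
  assumes "\<And>M. multidegree_coeff m M v s = multidegree_coeff m M u s"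
  shows "v s = u s"
proof (rule poly_mapping_eqI)
  fix k
  have "k + lcm_monom m s - lcm_monom m s = k" by simp
  then show "Poly_Mapping.lookup (v s) k = Poly_Mapping.lookup (u s) k"
    using assms[of "k + lcm_monom m s"] by (simp add: multidegree_coeff_def)
qed

text \<open>In each multidegree \<open>M\<close> the Taylor complex is the chain complex of the simplex whose vertices are the
generators dividing \<open>M\<close>; the monomial factors of the boundary map disappear.\<close>

lemma multidegree_coeff_taylor_boundary:
  fixes v :: "nat set \<Rightarrow> ('v::finite, 'k::comm_ring_1) mpoly"
  assumes t: "finite t"
  shows "multidegree_coeff m M (taylor_boundary m N v) t = simplex_boundary N (multidegree_coeff m M v) t"
proof (cases "lcm_monom m t mdvd M")
  case True
  have "Poly_Mapping.lookup (Poly_Mapping.single (lcm_monom m (insert i t) - lcm_monom m t) c * q) (M - lcm_monom m t)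
      = (if lcm_monom m (insert i t) mdvd M then c * Poly_Mapping.lookup q (M - lcm_monom m (insert i t)) else 0)"
    for i c and q :: "('v, 'k) mpoly"
  proof -
    have ti: "lcm_monom m t mdvd lcm_monom m (insert i t)" using t by (intro lcm_monom_mono) auto
    have "lcm_monom m (insert i t) - lcm_monom m t mdvd M - lcm_monom m t \<longleftrightarrow> lcm_monom m (insert i t) mdvd M"
      using True ti unfolding monom_dvd_def lookup_minus by (metis diff_le_mono le_diff_iff)
    moreover have "M - lcm_monom m t - (lcm_monom m (insert i t) - lcm_monom m t) = M - lcm_monom m (insert i t)"
      using ti by (intro poly_mapping_eqI) (simp add: monom_dvd_def lookup_minus)
    ultimately show ?thesis by (simp add: lookup_single_mult)
  qed
  then show ?thesis
    using True unfolding simplex_boundary_def multidegree_coeff_def taylor_boundary_def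
    by (simp add: lookup_sum) (intro sum.cong, auto)
next
  case False
  then have "\<not> lcm_monom m (insert i t) mdvd M" for i
    using mdvd_trans[OF lcm_monom_mono[of "insert i t" t m]] t by auto
  then show ?thesis using False by (simp add: simplex_boundary_def multidegree_coeff_def)
qed

lemma taylor_boundary_boundary:
  assumes t: "t \<subseteq> {..<N}"
  shows "taylor_boundary m N (taylor_boundary m N v) t = 0"
proof -
  have fin: "finite s" if "s \<subseteq> {..<N}" for s :: "nat set" using that finite_subset by blast
  have "multidegree_coeff m M (taylor_boundary m N (taylor_boundary m N v)) t = multidegree_coeff m M (\<lambda>_. 0) t" for M
  proof -
    have "multidegree_coeff m M (taylor_boundary m N (taylor_boundary m N v)) t
        = simplex_boundary N (multidegree_coeff m M (taylor_boundary m N v)) t"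
      by (rule multidegree_coeff_taylor_boundary[OF fin[OF t]])
    also have "\<dots> = simplex_boundary N (simplex_boundary N (multidegree_coeff m M v)) t"
      unfolding simplex_boundary_def[of N _ t]
      using t fin by (intro sum.cong refl) (auto simp: multidegree_coeff_taylor_boundary)
    also have "\<dots> = 0" by (rule simplex_boundary_boundary[OF t])
    finally show ?thesis by (simp add: multidegree_coeff_def)
  qed
  then show ?thesis by (rule multidegree_coeff_eqI[where u = "\<lambda>_. 0"])
qed

text \<open>The preimage \<open>u\<close> is built in each multidegree \<open>M\<close> by the cone at the least generator \<open>i0 M\<close> that divides
\<open>M\<close>. If no generator divides \<open>M\<close>, there are no nonzero coefficients on nonempty faces, and \<open>u\<close> is \<open>0\<close> in
that multidegree. Since \<open>u s\<close> involves only the finitely many polynomials \<open>v (s - {i})\<close> with \<open>i \<in> s\<close>, it has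
finite support.\<close>

lemma taylor_exact:
  fixes v :: "nat set \<Rightarrow> ('v::finite, 'k::comm_ring_1) mpoly"
  assumes cyc: "\<And>t. t \<subseteq> {..<N} \<Longrightarrow> card t = r \<Longrightarrow> taylor_boundary m N v t = 0"
  shows "\<exists>u. \<forall>t. t \<subseteq> {..<N} \<longrightarrow> card t = Suc r \<longrightarrow> taylor_boundary m N u t = v t"
proof -
  define S where "S M = {i. i < N \<and> m i mdvd M}" for M
  define i0 where "i0 M = Min (S M)" for M
  define w where "w M = (multidegree_coeff m M v :: nat set \<Rightarrow> 'k)" for M
  have finS: "finite (S M)" for M by (simp add: S_def)
  have i0: "i0 M \<in> S M" "\<And>j. j \<in> S M \<Longrightarrow> i0 M \<le> j" if "S M \<noteq> {}" for M
    using that finS by (auto simp: i0_def)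
  have fin: "finite s" if "s \<subseteq> {..<N}" for s :: "nat set" using that finite_subset by blast
  define h where "h M s = (if S M \<noteq> {} then cone_at (i0 M) (w M) s else 0)" for M s
  define u where "u s = Abs_poly_mapping (\<lambda>k. h (k + lcm_monom m s) s)" for s
  have u: "Poly_Mapping.lookup (u s) k = h (k + lcm_monom m s) s" if s: "s \<subseteq> {..<N}" for s k
  proof -
    let ?l = "\<lambda>i. lcm_monom m s - lcm_monom m (s - {i})"
    have "{k. h (k + lcm_monom m s) s \<noteq> 0} \<subseteq> (\<Union>i\<in>s. (\<lambda>k. k + ?l i) -` Poly_Mapping.keys (v (s - {i})))"
    proof
      fix k assume "k \<in> {k. h (k + lcm_monom m s) s \<noteq> 0}"
      then obtain i where i: "i \<in> s" "w (k + lcm_monom m s) (s - {i}) \<noteq> 0"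
        by (auto simp: h_def cone_at_def split: if_splits)
      have "lcm_monom m (s - {i}) mdvd lcm_monom m s" using fin[OF s] by (intro lcm_monom_mono) auto
      then have "k + lcm_monom m s - lcm_monom m (s - {i}) = k + ?l i"
        by (intro poly_mapping_eqI) (simp add: lookup_add lookup_minus monom_dvd_def)
      then show "k \<in> (\<Union>i\<in>s. (\<lambda>k. k + ?l i) -` Poly_Mapping.keys (v (s - {i})))"
        using i by (auto simp: w_def multidegree_coeff_def in_keys_iff split: if_splits)
    qed
    moreover have "finite (\<Union>i\<in>s. (\<lambda>k. k + ?l i) -` Poly_Mapping.keys (v (s - {i})))"
      using fin[OF s] by (intro finite_UN_I finite_vimageI) (auto simp: inj_on_def)
    ultimately have "finite {k. h (k + lcm_monom m s) s \<noteq> 0}" by (rule finite_subset)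
    then show ?thesis by (simp add: u_def)
  qed
  have supp: "w M s = 0" if "\<not> s \<subseteq> S M" "s \<subseteq> {..<N}" for M s
  proof -
    have "\<not> lcm_monom m s mdvd M" using that fin[of s] by (auto simp: lcm_monom_mdvd_iff S_def)
    then show ?thesis by (simp add: w_def multidegree_coeff_def)
  qed
  have hu: "multidegree_coeff m M u s = h M s" if s: "s \<subseteq> {..<N}" for M s
  proof (cases "lcm_monom m s mdvd M")
    case True
    then show ?thesis by (simp add: multidegree_coeff_def u[OF s] mdvd_diff_add)
  next
    case False
    have "h M s = 0"
    proof (rule ccontr)
      assume "h M s \<noteq> 0"
      then have *: "S M \<noteq> {}" "i0 M \<in> s" "w M (s - {i0 M}) \<noteq> 0"
        by (auto simp: h_def cone_at_def split: if_splits)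
      then have "s - {i0 M} \<subseteq> S M" using supp[of "s - {i0 M}" M] s by auto
      then have "s \<subseteq> S M" using i0 * by auto
      then show False using False fin[OF s] by (auto simp: lcm_monom_mdvd_iff S_def)
    qed
    then show ?thesis using False by (simp add: multidegree_coeff_def)
  qed
  have "taylor_boundary m N u t = v t" if t: "t \<subseteq> {..<N}" "card t = Suc r" for t
  proof (rule multidegree_coeff_eqI)
    fix M
    have "multidegree_coeff m M (taylor_boundary m N u) t = simplex_boundary N (multidegree_coeff m M u) t"
      by (rule multidegree_coeff_taylor_boundary[OF fin[OF t(1)]])
    also have "\<dots> = simplex_boundary N (h M) t"
      unfolding simplex_boundary_def using t by (intro sum.cong refl) (simp add: hu)
    also have "\<dots> = w M t"
    proof (cases "S M = {}")
      case True
      moreover have "t \<noteq> {}" using t by auto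
      ultimately have "w M t = 0" using supp[of t M] t by auto
      then show ?thesis using True by (simp add: h_def simplex_boundary_def)
    next
      case False
      \<comment> \<open>The cone lemma asks for a support condition on arbitrary sets, so \<open>w M\<close> is cut off outside the full simplex.\<close>
      define w' where "w' s = (if s \<subseteq> {..<N} then w M s else 0)" for s
      have bw: "simplex_boundary N w' s = simplex_boundary N (w M) s" if "s \<subseteq> {..<N}" for s
        unfolding simplex_boundary_def using that by (intro sum.cong refl) (simp add: w'_def)
      have "simplex_boundary N (h M) t = simplex_boundary N (cone_at (i0 M) w') t"
        unfolding simplex_boundary_def using t False
        by (intro sum.cong refl) (auto simp: h_def cone_at_def w'_def)
      also have "\<dots> = w' t - cone_at (i0 M) (simplex_boundary N w') t"
        by (rule simplex_boundary_cone[OF _ i0[OF False] _ t(1)])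
          (auto simp: S_def w'_def intro!: supp)
      also have "cone_at (i0 M) (simplex_boundary N w') t = 0"
      proof (cases "i0 M \<in> t")
        case True
        define t' where "t' = t - {i0 M}"
        have t': "t' \<subseteq> {..<N}" "card t' = r" using t True fin[OF t(1)] by (auto simp: t'_def)
        have "simplex_boundary N w' t' = multidegree_coeff m M (taylor_boundary m N v) t'"
          unfolding bw[OF t'(1)] w_def by (rule multidegree_coeff_taylor_boundary[OF fin[OF t'(1)], symmetric])
        also have "\<dots> = 0" using cyc[OF t'] by (simp add: multidegree_coeff_def)
        finally show ?thesis using True by (simp add: cone_at_def t'_def)
      qed (simp add: cone_at_def)
      finally show ?thesis using t by (simp add: w'_def)
    qed
    finally show "multidegree_coeff m M (taylor_boundary m N u) t = multidegree_coeff m M v t"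
      by (simp add: w_def)
  qed
  then show ?thesis by blast
qed

section \<open>The Taylor resolution as a complex of matrices\<close>

text \<open>Any order of the faces gives a basis, so an arbitrary enumeration is chosen.\<close>

definition faces :: "nat \<Rightarrow> nat \<Rightarrow> nat set list" where
  "faces N r = (SOME L. distinct L \<and> set L = {s. s \<subseteq> {..<N} \<and> card s = r})"

lemma faces: "distinct (faces N r)" "set (faces N r) = {s. s \<subseteq> {..<N} \<and> card s = r}"
proof -
  have "finite {s. s \<subseteq> {..<N} \<and> card s = r}"
    by (rule finite_subset[of _ "Pow {..<N}"]) auto
  from finite_distinct_list[OF this]
  have "\<exists>L. distinct L \<and> set L = {s. s \<subseteq> {..<N} \<and> card s = r}" by (simp only: conj_commute)
  then have "distinct (faces N r) \<and> set (faces N r) = {s. s \<subseteq> {..<N} \<and> card s = r}"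
    unfolding faces_def by (rule someI_ex)
  then show "distinct (faces N r)" "set (faces N r) = {s. s \<subseteq> {..<N} \<and> card s = r}" by auto
qed

lemma faces_nth:
  assumes "b < length (faces N r)"
  shows "faces N r ! b \<subseteq> {..<N}" "card (faces N r ! b) = r" "finite (faces N r ! b)"
  using nth_mem[OF assms] finite_subset[of "faces N r ! b" "{..<N}"] by (auto simp: faces(2))

lemma faces_0: "faces N 0 = [{}]"
proof -
  have "s = {}" if "s \<subseteq> {..<N}" "card s = 0" for s :: "nat set"
    using that finite_subset[OF that(1)] by simp
  then have S: "set (faces N 0) = {{}}" unfolding faces(2) by auto
  then have "length (faces N 0) = 1"
    using distinct_card[OF faces(1)[of N 0]] by simp
  then obtain x where "faces N 0 = [x]" by (auto simp: length_Suc_conv)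
  then show ?thesis using S by simp
qed

text \<open>Translation between vectors, indexed by positions in a list \<open>L\<close> of faces, and functions on faces.\<close>

definition face_coord :: "nat set list \<Rightarrow> 'a vec \<Rightarrow> nat set \<Rightarrow> 'a" where
  "face_coord L v s = v $ (THE b. b < length L \<and> L ! b = s)"

definition face_vec :: "nat set list \<Rightarrow> (nat set \<Rightarrow> 'a) \<Rightarrow> 'a vec" where
  "face_vec L u = vec (length L) (\<lambda>b. u (L ! b))"

lemma face_coord_nth: "distinct L \<Longrightarrow> b < length L \<Longrightarrow> face_coord L v (L ! b) = v $ b"
  unfolding face_coord_def by (rule arg_cong[of _ _ "vec_index v"], rule the_equality)
    (auto simp: nth_eq_iff_index_eq)

lemma face_coord_face_vec: "distinct L \<Longrightarrow> s \<in> set L \<Longrightarrow> face_coord L (face_vec L u) s = u s"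
  by (auto simp: in_set_conv_nth face_coord_nth face_vec_def)

text \<open>The coefficient of \<open>e\<^sub>t\<close> in the boundary of \<open>e\<^sub>s\<close>.\<close>

definition taylor_entry ::
    "(nat \<Rightarrow> 'v::finite \<Rightarrow>\<^sub>0 nat) \<Rightarrow> nat set \<Rightarrow> nat set \<Rightarrow> ('v, 'k::comm_ring_1) mpoly" where
  "taylor_entry m t s = (if \<exists>i. i \<notin> t \<and> s = insert i t
     then Poly_Mapping.single (lcm_monom m s - lcm_monom m t) (face_sign (the_elem (s - t)) t) else 0)"

definition taylor_diff :: "(nat \<Rightarrow> 'v::finite \<Rightarrow>\<^sub>0 nat) \<Rightarrow> nat \<Rightarrow> nat \<Rightarrow> ('v, 'k::comm_ring_1) mpoly mat" where
  "taylor_diff m N r = mat (length (faces N r)) (length (faces N (Suc r)))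
     (\<lambda>(a, b). taylor_entry m (faces N r ! a) (faces N (Suc r) ! b))"

definition taylor_resolution :: "(nat \<Rightarrow> 'v::finite \<Rightarrow>\<^sub>0 nat) \<Rightarrow> nat \<Rightarrow> ('v, 'k::comm_ring_1) free_complex" where
  "taylor_resolution m N = \<lparr>gens = (\<lambda>r. map (\<lambda>s. mdeg (lcm_monom m s)) (faces N r)),
     diff = taylor_diff m N, aug = vec (length (faces N 0)) (\<lambda>_. 1)\<rparr>"

lemma taylor_diff_carrier:
  "taylor_diff m N r \<in> carrier_mat (length (faces N r)) (length (faces N (Suc r)))"
  by (simp add: taylor_diff_def)

lemma taylor_entry_insert:
  "i \<notin> t \<Longrightarrow> taylor_entry m t (insert i t)
    = Poly_Mapping.single (lcm_monom m (insert i t) - lcm_monom m t) (face_sign i t)"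
proof -
  assume i: "i \<notin> t"
  then have D: "insert i t - t = {i}" by auto
  have ex: "\<exists>j. j \<notin> t \<and> insert i t = insert j t" using i by blast
  show ?thesis unfolding taylor_entry_def if_P[OF ex] D by simp
qed

lemma taylor_diff_mult:
  fixes v :: "('v::finite, 'k::comm_ring_1) mpoly vec"
  assumes v: "v \<in> carrier_vec (length (faces N (Suc r)))" and a: "a < length (faces N r)"
  shows "(taylor_diff m N r *\<^sub>v v) $ a = taylor_boundary m N (face_coord (faces N (Suc r)) v) (faces N r ! a)"
proof -
  define L where "L = faces N (Suc r)"
  define t where "t = faces N r ! a"
  have t: "t \<subseteq> {..<N}" "card t = r" "finite t" using faces_nth[OF a] by (auto simp: t_def)
  have "(taylor_diff m N r *\<^sub>v v) $ a = (\<Sum>b<length L. taylor_entry m t (L ! b) * v $ b)"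
    using v a by (auto simp: taylor_diff_def scalar_prod_def lessThan_atLeast0 t_def L_def)
  also have "\<dots> = (\<Sum>b<length L. taylor_entry m t (L ! b) * face_coord L v (L ! b))"
    using faces(1)[of N "Suc r"] by (intro sum.cong) (auto simp: face_coord_nth L_def)
  also have "\<dots> = (\<Sum>s\<in>set L. taylor_entry m t s * face_coord L v s)"
    using faces(1)[of N "Suc r"]
    by (intro sum.reindex_bij_betw bij_betw_nth) (auto simp: L_def)
  also have "\<dots> = (\<Sum>s \<in> (\<lambda>i. insert i t) ` ({..<N} - t). taylor_entry m t s * face_coord L v s)"
  proof (rule sum.mono_neutral_right)
    show "(\<lambda>i. insert i t) ` ({..<N} - t) \<subseteq> set L" using t by (auto simp: L_def faces(2))
    show "\<forall>s \<in> set L - (\<lambda>i. insert i t) ` ({..<N} - t). taylor_entry m t s * face_coord L v s = 0"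
      by (auto simp: L_def faces(2) taylor_entry_def)
  qed simp
  also have "\<dots> = (\<Sum>i \<in> {..<N} - t. taylor_entry m t (insert i t) * face_coord L v (insert i t))"
    by (rule sum.reindex_cong[OF _ refl refl]) (auto simp: inj_on_def)
  also have "\<dots> = taylor_boundary m N (face_coord L v) t"
    unfolding taylor_boundary_def by (intro sum.cong) (auto simp: taylor_entry_insert)
  finally show ?thesis by (simp add: L_def t_def)
qed

lemma taylor_boundary_cong:
  assumes "\<And>i. i < N \<Longrightarrow> i \<notin> t \<Longrightarrow> v (insert i t) = u (insert i t)"
  shows "taylor_boundary m N v t = taylor_boundary m N u t"
  unfolding taylor_boundary_def using assms by (intro sum.cong) auto

lemma taylor_diff_exact:
  "mat_kernel (taylor_diff m N r :: ('v::finite, 'k::comm_ring_1) mpoly mat)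
    = (\<lambda>u. taylor_diff m N (Suc r) *\<^sub>v u) ` carrier_vec (length (faces N (Suc (Suc r))))"
    (is "_ = ?im")
proof (rule Set.set_eqI, rule iffI)
  fix v :: "('v, 'k) mpoly vec" assume "v \<in> ?im"
  then obtain u where u: "u \<in> carrier_vec (length (faces N (Suc (Suc r))))" "v = taylor_diff m N (Suc r) *\<^sub>v u"
    by auto
  have v: "v \<in> carrier_vec (length (faces N (Suc r)))"
    unfolding u(2) by (rule mult_mat_vec_carrier[OF taylor_diff_carrier u(1)])
  have "taylor_diff m N r *\<^sub>v v = 0\<^sub>v (length (faces N r))"
  proof (rule eq_vecI)
    fix a assume "a < dim_vec (0\<^sub>v (length (faces N r)) :: ('v, 'k) mpoly vec)"
    then have a: "a < length (faces N r)" by simp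
    note t = faces_nth[OF a]
    have "(taylor_diff m N r *\<^sub>v v) $ a = taylor_boundary m N (face_coord (faces N (Suc r)) v) (faces N r ! a)"
      by (rule taylor_diff_mult[OF v a])
    also have "\<dots> = taylor_boundary m N (taylor_boundary m N (face_coord (faces N (Suc (Suc r))) u)) (faces N r ! a)"
    proof (rule taylor_boundary_cong)
      fix i assume "i < N" "i \<notin> faces N r ! a"
      then have "insert i (faces N r ! a) \<in> set (faces N (Suc r))" using t by (auto simp: faces(2))
      then obtain b where b: "b < length (faces N (Suc r))" "faces N (Suc r) ! b = insert i (faces N r ! a)"
        by (auto simp: in_set_conv_nth)
      show "face_coord (faces N (Suc r)) v (insert i (faces N r ! a))
          = taylor_boundary m N (face_coord (faces N (Suc (Suc r))) u) (insert i (faces N r ! a))"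
        unfolding b(2)[symmetric] face_coord_nth[OF faces(1) b(1)] u(2) by (rule taylor_diff_mult[OF u(1) b(1)])
    qed
    also have "\<dots> = 0" by (rule taylor_boundary_boundary[OF t(1)])
    finally show "(taylor_diff m N r *\<^sub>v v) $ a = 0\<^sub>v (length (faces N r)) $ a" using a by simp
  qed (use taylor_diff_carrier[of m N r] in auto)
  then show "v \<in> mat_kernel (taylor_diff m N r)" by (rule mat_kernelI[OF taylor_diff_carrier v])
next
  fix v :: "('v, 'k) mpoly vec" assume "v \<in> mat_kernel (taylor_diff m N r)"
  then have v: "v \<in> carrier_vec (length (faces N (Suc r)))" "taylor_diff m N r *\<^sub>v v = 0\<^sub>v (length (faces N r))"
    using mat_kernelD[OF taylor_diff_carrier] by auto
  have "taylor_boundary m N (face_coord (faces N (Suc r)) v) t = 0" if "t \<subseteq> {..<N}" "card t = r" for t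
  proof -
    have "t \<in> set (faces N r)" using that by (simp add: faces(2))
    then obtain a where "a < length (faces N r)" "t = faces N r ! a" by (auto simp: in_set_conv_nth)
    then show ?thesis using taylor_diff_mult[OF v(1), of a m] v(2) by simp
  qed
  then obtain u where u: "\<And>t. t \<subseteq> {..<N} \<Longrightarrow> card t = Suc r \<Longrightarrow> taylor_boundary m N u t = face_coord (faces N (Suc r)) v t"
    using taylor_exact[of N r m] by blast
  define w where "w = face_vec (faces N (Suc (Suc r))) u"
  have w: "w \<in> carrier_vec (length (faces N (Suc (Suc r))))" by (simp add: w_def face_vec_def)
  have "taylor_diff m N (Suc r) *\<^sub>v w = v"
  proof (rule eq_vecI)
    fix a assume "a < dim_vec v"
    then have a: "a < length (faces N (Suc r))" using v by simp
    note t = faces_nth[OF a]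
    have "(taylor_diff m N (Suc r) *\<^sub>v w) $ a
        = taylor_boundary m N (face_coord (faces N (Suc (Suc r))) w) (faces N (Suc r) ! a)"
      by (rule taylor_diff_mult[OF w a])
    also have "\<dots> = taylor_boundary m N u (faces N (Suc r) ! a)"
      using t unfolding w_def
      by (intro taylor_boundary_cong face_coord_face_vec[OF faces(1)]) (auto simp: faces(2))
    also have "\<dots> = v $ a"
      unfolding u[OF t(1,2)] by (rule face_coord_nth[OF faces(1) a])
    finally show "(taylor_diff m N (Suc r) *\<^sub>v w) $ a = v $ a" .
  qed (use v taylor_diff_carrier[of m N "Suc r"] in auto)
  then show "v \<in> ?im" using w by auto
qed

definition monomial_ideal :: "(nat \<Rightarrow> 'v \<Rightarrow>\<^sub>0 nat) \<Rightarrow> nat \<Rightarrow> ('v, 'k::comm_ring_1) mpoly set" where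
  "monomial_ideal m N = ideal.span ((\<lambda>i. Poly_Mapping.single (m i) 1) ` {..<N})"

lemma monomial_ideal_eq:
  fixes m :: "nat \<Rightarrow> 'v \<Rightarrow>\<^sub>0 nat"
  shows "(monomial_ideal m N :: ('v, 'k::comm_ring_1) mpoly set)
    = range (\<lambda>u. \<Sum>i<N. Poly_Mapping.single (m i) 1 * u i)" (is "_ = ?R")
proof
  show "monomial_ideal m N \<subseteq> ?R"
    unfolding monomial_ideal_def
  proof (rule ideal.span_minimal)
    show "(\<lambda>i. Poly_Mapping.single (m i) 1) ` {..<N} \<subseteq> ?R"
    proof
      fix p assume "p \<in> (\<lambda>i. Poly_Mapping.single (m i) 1 :: ('v, 'k) mpoly) ` {..<N}"
      then obtain i where i: "i < N" "p = Poly_Mapping.single (m i) 1" by auto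
      then have "p = (\<Sum>j<N. Poly_Mapping.single (m j) 1 * (if j = i then 1 else 0))"
        by (simp add: if_distrib cong: if_cong)
      then show "p \<in> ?R" by (rule range_eqI[where x = "\<lambda>j. if j = i then 1 else 0"])
    qed
    show "ideal.subspace ?R"
    proof (rule ideal.subspaceI)
      have "(0 :: ('v, 'k) mpoly) = (\<Sum>i<N. Poly_Mapping.single (m i) 1 * 0)" by simp
      then show "(0 :: ('v, 'k) mpoly) \<in> ?R" by (rule range_eqI[where x = "\<lambda>_. 0"])
    next
      fix p q :: "('v, 'k) mpoly" assume "p \<in> ?R" "q \<in> ?R"
      then obtain u w where u: "p = (\<Sum>i<N. Poly_Mapping.single (m i) 1 * u i)"
        and w: "q = (\<Sum>i<N. Poly_Mapping.single (m i) 1 * w i)" by (elim rangeE)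
      have "p + q = (\<Sum>i<N. Poly_Mapping.single (m i) 1 * (u i + w i))"
        unfolding u w by (simp add: sum.distrib distrib_left)
      then show "p + q \<in> ?R" by (rule range_eqI[where x = "\<lambda>i. u i + w i"])
    next
      fix c p :: "('v, 'k) mpoly" assume "p \<in> ?R"
      then obtain u where u: "p = (\<Sum>i<N. Poly_Mapping.single (m i) 1 * u i)" by (elim rangeE)
      have "c * p = (\<Sum>i<N. Poly_Mapping.single (m i) 1 * (c * u i))"
        unfolding u sum_distrib_left by (intro sum.cong refl mult.left_commute)
      then show "c * p \<in> ?R" by (rule range_eqI[where x = "\<lambda>i. c * u i"])
    qed
  qed
  show "?R \<subseteq> monomial_ideal m N"
  proof
    fix p assume "p \<in> ?R"
    then obtain u where u: "p = (\<Sum>i<N. Poly_Mapping.single (m i) 1 * u i)" by (elim rangeE)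
    have "(\<Sum>i<N. u i * Poly_Mapping.single (m i) 1) \<in> monomial_ideal m N"
      unfolding monomial_ideal_def by (intro ideal.span_sum ideal.span_scale ideal.span_base) auto
    then show "p \<in> monomial_ideal m N" unfolding u by (simp add: mult.commute)
  qed
qed

lemma homogeneous_ideal_monomial_ideal:
  "homogeneous_ideal (monomial_ideal m N :: ('v, 'k::comm_ring_1) mpoly set)"
  unfolding homogeneous_ideal_def
proof (intro conjI ballI allI)
  show "ideal.subspace (monomial_ideal m N :: ('v, 'k) mpoly set)" by (simp add: monomial_ideal_def)
  fix p :: "('v, 'k) mpoly" and d assume "p \<in> monomial_ideal m N"
  then obtain u where u: "p = (\<Sum>i<N. Poly_Mapping.single (m i) 1 * u i)"
    unfolding monomial_ideal_eq by (elim rangeE)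
  have h: "homogeneous (mdeg (m i)) (Poly_Mapping.single (m i) 1 :: ('v, 'k) mpoly)" for i
    by (simp add: homogeneous_def)
  have "degree_part d p = (\<Sum>i<N. Poly_Mapping.single (m i) 1 * (if mdeg (m i) \<le> d then degree_part (d - mdeg (m i)) (u i) else 0))"
    unfolding u degree_part_sum by (intro sum.cong refl) (simp add: degree_part_mult[OF h])
  then show "degree_part d p \<in> monomial_ideal m N" unfolding monomial_ideal_eq
    by (rule range_eqI[where x = "\<lambda>i. if mdeg (m i) \<le> d then degree_part (d - mdeg (m i)) (u i) else 0"])
qed

text \<open>Exactness at \<open>F\<^sub>0 = R\<close> is the description of the ideal as the set of combinations of the generators. In
higher degrees it is \<open>taylor_diff_exact\<close>.\<close>

theorem taylor_resolution:
  "graded_free_resolution (taylor_resolution m N :: ('v::finite, 'k::field) free_complex) (monomial_ideal m N)"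
proof -
  let ?F = "taylor_resolution m N :: ('v, 'k) free_complex"
  have rk: "rk ?F r = length (faces N r)" for r by (simp add: taylor_resolution_def)
  have d: "diff ?F r = taylor_diff m N r" for r by (simp add: taylor_resolution_def)
  have rk0: "rk ?F 0 = 1" by (simp add: rk faces_0)
  have aug: "aug ?F = vec 1 (\<lambda>_. 1)" by (simp add: taylor_resolution_def faces_0)
  have augv: "aug ?F \<bullet> v = v $ 0" if "v \<in> carrier_vec 1" for v
    using that by (simp add: aug scalar_prod_def)
  have hom: "gens ?F r ! i \<le> gens ?F (Suc r) ! j \<and>
      homogeneous (gens ?F (Suc r) ! j - gens ?F r ! i) (diff ?F r $$ (i, j))"
    if ij: "i < rk ?F r" "j < rk ?F (Suc r)" and nz: "diff ?F r $$ (i, j) \<noteq> 0" for r i j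
  proof -
    let ?t = "faces N r ! i" and ?s = "faces N (Suc r) ! j"
    have e: "diff ?F r $$ (i, j) = taylor_entry m ?t ?s"
      using ij by (simp add: rk d taylor_diff_def)
    then obtain l where "l \<notin> ?t" "?s = insert l ?t"
      using nz by (auto simp: taylor_entry_def split: if_splits)
    moreover have "finite ?s" using ij faces_nth(3)[of j N "Suc r"] by (simp add: rk)
    ultimately have "lcm_monom m ?t mdvd lcm_monom m ?s" by (intro lcm_monom_mono) auto
    then have "mdeg (lcm_monom m ?t) \<le> mdeg (lcm_monom m ?s)"
      "mdeg (lcm_monom m ?s - lcm_monom m ?t) = mdeg (lcm_monom m ?s) - mdeg (lcm_monom m ?t)"
      by (simp_all add: mdeg_mono mdeg_diff)
    then show ?thesis using ij unfolding e
      by (auto simp: taylor_resolution_def taylor_entry_def homogeneous_def)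
  qed
  have exact0: "{v \<in> carrier_vec (rk ?F 0). aug ?F \<bullet> v \<in> monomial_ideal m N}
      = (\<lambda>u. diff ?F 0 *\<^sub>v u) ` carrier_vec (rk ?F 1)"
  proof -
    have b: "(taylor_diff m N 0 *\<^sub>v u) $ 0 = (\<Sum>i<N. Poly_Mapping.single (m i) 1 * face_coord (faces N (Suc 0)) u {i})"
      if u: "u \<in> carrier_vec (length (faces N (Suc 0)))" for u :: "('v, 'k) mpoly vec"
      using taylor_diff_mult[OF u, of 0 m]
      by (simp add: faces_0 taylor_boundary_def face_sign_def)
    show ?thesis
    proof (rule Set.set_eqI, rule iffI)
      fix v assume "v \<in> {v \<in> carrier_vec (rk ?F 0). aug ?F \<bullet> v \<in> monomial_ideal m N}"
      then have v: "v \<in> carrier_vec 1" "v $ 0 \<in> monomial_ideal m N" using augv by (auto simp: rk0)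
      then obtain u where u: "v $ 0 = (\<Sum>i<N. Poly_Mapping.single (m i) 1 * u i)"
        unfolding monomial_ideal_eq by (elim rangeE)
      define w where "w = face_vec (faces N (Suc 0)) (\<lambda>s. u (the_elem s))"
      have w: "w \<in> carrier_vec (length (faces N (Suc 0)))" by (simp add: w_def face_vec_def)
      have "face_coord (faces N (Suc 0)) w {i} = u i" if "i < N" for i
        unfolding w_def using that by (subst face_coord_face_vec[OF faces(1)]) (auto simp: faces(2))
      then have "(taylor_diff m N 0 *\<^sub>v w) $ 0 = v $ 0" unfolding b[OF w] u by (intro sum.cong) auto
      moreover have "taylor_diff m N 0 *\<^sub>v w \<in> carrier_vec 1"
        using mult_mat_vec_carrier[OF taylor_diff_carrier w] by (simp add: faces_0)
      ultimately have "v = taylor_diff m N 0 *\<^sub>v w"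
        using v by (intro eq_vecI) (simp_all only: carrier_vecD less_one)
      then show "v \<in> (\<lambda>u. diff ?F 0 *\<^sub>v u) ` carrier_vec (rk ?F 1)" using w by (auto simp: d rk)
    next
      fix v assume "v \<in> (\<lambda>u. diff ?F 0 *\<^sub>v u) ` carrier_vec (rk ?F 1)"
      then obtain u where u: "u \<in> carrier_vec (length (faces N (Suc 0)))" "v = taylor_diff m N 0 *\<^sub>v u"
        by (auto simp: d rk)
      have "v \<in> carrier_vec 1"
        using mult_mat_vec_carrier[OF taylor_diff_carrier u(1)] u(2) by (simp add: faces_0)
      moreover have "v $ 0 \<in> monomial_ideal m N" unfolding u(2) b[OF u(1)] monomial_ideal_eq
        by (rule range_eqI[where x = "\<lambda>i. face_coord (faces N (Suc 0)) u {i}"]) (rule refl)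
      ultimately show "v \<in> {v \<in> carrier_vec (rk ?F 0). aug ?F \<bullet> v \<in> monomial_ideal m N}"
        using augv by (simp add: rk0)
    qed
  qed
  have onto: "\<exists>v \<in> carrier_vec (rk ?F 0). p - aug ?F \<bullet> v \<in> monomial_ideal m N" for p
  proof (rule bexI[of _ "vec 1 (\<lambda>_. p)"])
    have "p - aug ?F \<bullet> vec 1 (\<lambda>_. p) = 0" by (simp add: augv)
    then show "p - aug ?F \<bullet> vec 1 (\<lambda>_. p) \<in> monomial_ideal m N"
      unfolding monomial_ideal_def by (simp only: ideal.span_zero)
  qed (simp add: rk0)
  show ?thesis
    unfolding graded_free_resolution_def
  proof (intro conjI allI impI)
    show "diff ?F r \<in> carrier_mat (rk ?F r) (rk ?F (Suc r))" for r
      unfolding d rk by (rule taylor_diff_carrier)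
    show "aug ?F \<in> carrier_vec (rk ?F 0)" by (simp add: aug rk0)
    show "homogeneous (gens ?F 0 ! j) (aug ?F $ j)" if "j < rk ?F 0" for j
      using that by (simp add: aug rk0 taylor_resolution_def faces_0 homogeneous_def)
    show "mat_kernel (diff ?F r) = (\<lambda>u. diff ?F (Suc r) *\<^sub>v u) ` carrier_vec (rk ?F (Suc (Suc r)))" for r
      unfolding d rk by (rule taylor_diff_exact)
  qed (use hom exact0 onto in auto)
qed

section \<open>Betti numbers of monomial ideals\<close>

text \<open>The constant term of the entry \<open>\<plusminus> lcm s / lcm t\<close> is nonzero exactly if \<open>lcm s = lcm t\<close>.\<close>

lemma res_diff_taylor_resolution_eq:
  fixes m m' :: "nat \<Rightarrow> 'v::finite \<Rightarrow>\<^sub>0 nat"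
  assumes eq: "\<And>s t. s \<subseteq> {..<N} \<Longrightarrow> t \<subseteq> s \<Longrightarrow>
    lcm_monom m s = lcm_monom m t \<longleftrightarrow> lcm_monom m' s = lcm_monom m' t"
  shows "res_diff (taylor_resolution m N :: ('v, 'k::field) free_complex) r
    = res_diff (taylor_resolution m' N :: ('v, 'k) free_complex) r"
proof (cases r)
  case 0
  then show ?thesis by (simp add: res_diff_def taylor_resolution_def)
next
  case (Suc q)
  have "Poly_Mapping.lookup (taylor_entry m t s :: ('v, 'k) mpoly) 0 = Poly_Mapping.lookup (taylor_entry m' t s :: ('v, 'k) mpoly) 0"
    if s: "s \<subseteq> {..<N}" for s t
  proof (cases "\<exists>i. i \<notin> t \<and> s = insert i t")
    case True
    then have ts: "t \<subseteq> s" "finite s" using finite_subset[OF s] by auto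
    have "(lcm_monom m s - lcm_monom m t = 0) = (lcm_monom m' s - lcm_monom m' t = 0)"
      using eq[OF s ts(1)] ts by (simp add: mdvd_diff_eq_0_iff lcm_monom_mono)
    then show ?thesis using True by (simp add: taylor_entry_def lookup_single)
  next
    case False
    show ?thesis unfolding taylor_entry_def if_not_P[OF False] by simp
  qed
  then show ?thesis using Suc
    by (intro eq_matI) (auto simp: res_diff_def taylor_resolution_def taylor_diff_def faces_nth)
qed

theorem total_betti_monomial_ideal_eq:
  fixes m m' :: "nat \<Rightarrow> 'v::finite \<Rightarrow>\<^sub>0 nat"
  assumes "\<And>s t. s \<subseteq> {..<N} \<Longrightarrow> t \<subseteq> s \<Longrightarrow>
    lcm_monom m s = lcm_monom m t \<longleftrightarrow> lcm_monom m' s = lcm_monom m' t"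
  shows "total_betti r (monomial_ideal m N :: ('v, 'k::field) mpoly set)
    = total_betti r (monomial_ideal m' N :: ('v, 'k) mpoly set)"
proof -
  have "res_diff (taylor_resolution m N :: ('v, 'k) free_complex) q
      = res_diff (taylor_resolution m' N :: ('v, 'k) free_complex) q" for q
    by (rule res_diff_taylor_resolution_eq) (rule assms)
  then show ?thesis
    unfolding betti_eq_resolution(2)[OF taylor_resolution homogeneous_ideal_monomial_ideal] by simp
qed

theorem betti_monomial_ideal_eq:
  fixes m m' :: "nat \<Rightarrow> 'v::finite \<Rightarrow>\<^sub>0 nat"
  assumes deg: "\<And>s. s \<subseteq> {..<N} \<Longrightarrow> mdeg (lcm_monom m s) = mdeg (lcm_monom m' s)"
  shows "graded_betti r d (monomial_ideal m N :: ('v, 'k::field) mpoly set)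
    = graded_betti r d (monomial_ideal m' N :: ('v, 'k) mpoly set)"
    and "total_betti r (monomial_ideal m N :: ('v, 'k::field) mpoly set)
    = total_betti r (monomial_ideal m' N :: ('v, 'k) mpoly set)"
proof -
  have eq: "lcm_monom m s = lcm_monom m t \<longleftrightarrow> lcm_monom m' s = lcm_monom m' t"
    if s: "s \<subseteq> {..<N}" and ts: "t \<subseteq> s" for s t
  proof -
    have "finite s" "t \<subseteq> {..<N}" using s ts finite_subset by auto
    then show ?thesis
      using deg[OF s] deg[of t] ts by (simp add: mdvd_eq_iff_mdeg lcm_monom_mono)
  qed
  show "total_betti r (monomial_ideal m N :: ('v, 'k) mpoly set)
      = total_betti r (monomial_ideal m' N :: ('v, 'k) mpoly set)"
    by (rule total_betti_monomial_ideal_eq[OF eq])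
  let ?F = "taylor_resolution m N :: ('v, 'k) free_complex"
    and ?F' = "taylor_resolution m' N :: ('v, 'k) free_complex"
  have "gens ?F = gens ?F'"
    using deg faces(2) by (auto simp: taylor_resolution_def fun_eq_iff)
  moreover have "res_diff ?F q = res_diff ?F' q" for q
    by (rule res_diff_taylor_resolution_eq) (rule eq)
  ultimately have "graded_res_diff ?F q d = graded_res_diff ?F' q d" for q
    by (simp add: graded_res_diff_def gens_of_degree_def)
  then show "graded_betti r d (monomial_ideal m N :: ('v, 'k) mpoly set)
      = graded_betti r d (monomial_ideal m' N :: ('v, 'k) mpoly set)"
    unfolding betti_eq_resolution(1)[OF taylor_resolution homogeneous_ideal_monomial_ideal] by simp
qed

section \<open>Degrees of least common multiples\<close>

lemma mdeg_eq_sum_UNIV: "mdeg (m :: 'v::finite \<Rightarrow>\<^sub>0 nat) = (\<Sum>v\<in>UNIV. Poly_Mapping.lookup m v)"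
  unfolding mdeg_def by (intro sum.mono_neutral_left) (auto simp: in_keys_iff)

text \<open>Among the nonzero values of \<open>f\<close> all but the maximal one are equal to \<open>1\<close>.\<close>

lemma Max_plus_card_eq_sum:
  fixes f :: "nat \<Rightarrow> nat"
  assumes s: "finite s" and f: "\<And>i. i \<in> s \<Longrightarrow> i \<noteq> i0 \<Longrightarrow> f i \<le> 1"
  shows "Max (insert 0 (f ` s)) + (card {i \<in> s. f i \<noteq> 0} - 1) = (\<Sum>i\<in>s. f i)"
proof -
  define P where "P = {i \<in> s. f i \<noteq> 0}"
  have P: "finite P" "P \<subseteq> s" using s by (auto simp: P_def)
  have sum: "(\<Sum>i\<in>s. f i) = (\<Sum>i\<in>P. f i)"
    using s by (intro sum.mono_neutral_right) (auto simp: P_def)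
  consider "P = {}" | "i0 \<in> P" | "P \<noteq> {}" "i0 \<notin> P" by blast
  then have "Max (insert 0 (f ` s)) + (card P - 1) = (\<Sum>i\<in>P. f i)"
  proof cases
    case 1
    then have "f i = 0" if "i \<in> s" for i using that by (auto simp: P_def)
    then have "Max (insert 0 (f ` s)) = 0" using s by (intro Max_eqI) auto
    then show ?thesis using 1 by simp
  next
    case 2
    have one: "f i = 1" if "i \<in> P - {i0}" for i
      using that f[of i] by (auto simp: P_def)
    have "f i \<le> f i0" if "i \<in> s" for i
      using that f[of i] 2 by (cases "i = i0") (auto simp: P_def)
    then have "Max (insert 0 (f ` s)) = f i0" using s 2 by (intro Max_eqI) (auto simp: P_def)
    moreover have "(\<Sum>i\<in>P. f i) = f i0 + (\<Sum>i \<in> P - {i0}. f i)" by (rule sum.remove[OF P(1) 2])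
    moreover have "(\<Sum>i \<in> P - {i0}. f i) = card P - 1"
      using one P(1) 2 by (simp add: card_Diff_singleton)
    ultimately show ?thesis by simp
  next
    case 3
    have one: "f i = 1" if "i \<in> P" for i
      using that f[of i] 3 by (force simp: P_def)
    obtain i where i: "i \<in> P" using 3 by auto
    have "f j \<le> 1" if "j \<in> s" for j
      using that one[of j] by (cases "f j = 0") (auto simp: P_def)
    moreover have "1 \<in> insert 0 (f ` s)" using i one[OF i] P by force
    ultimately have "Max (insert 0 (f ` s)) = 1" using s by (intro Max_eqI) auto
    moreover have "card P > 0" using i P(1) by (auto simp: card_gt_0_iff)
    ultimately show ?thesis using one by simp
  qed
  then show ?thesis unfolding sum P_def .
qed

text \<open>The previous lemma applied to the exponents of each vertex. The correction term depends only on
which generators contain which vertices, not on the exponents.\<close>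

lemma mdeg_lcm_monom:
  fixes m :: "nat \<Rightarrow> 'v::finite \<Rightarrow>\<^sub>0 nat"
  assumes s: "s \<subseteq> {..<N}"
    and m: "\<And>v. \<exists>i0. \<forall>i<N. i \<noteq> i0 \<longrightarrow> Poly_Mapping.lookup (m i) v \<le> 1"
  shows "mdeg (lcm_monom m s) + (\<Sum>v\<in>UNIV. card {i \<in> s. Poly_Mapping.lookup (m i) v \<noteq> 0} - 1)
    = (\<Sum>i\<in>s. mdeg (m i))"
proof -
  have fin: "finite s" using s finite_subset by blast
  have "Poly_Mapping.lookup (lcm_monom m s) v + (card {i \<in> s. Poly_Mapping.lookup (m i) v \<noteq> 0} - 1)
      = (\<Sum>i\<in>s. Poly_Mapping.lookup (m i) v)" for v
  proof -
    obtain i0 where i0: "\<And>i. i < N \<Longrightarrow> i \<noteq> i0 \<Longrightarrow> Poly_Mapping.lookup (m i) v \<le> 1"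
      using m[of v] by blast
    show ?thesis unfolding lookup_lcm_monom
      by (rule Max_plus_card_eq_sum[OF fin, of i0]) (use i0 s in auto)
  qed
  then show ?thesis
    unfolding mdeg_eq_sum_UNIV sum.distrib[symmetric] by (simp add: sum.swap[of _ s])
qed

lemma mdeg_lcm_monom_eq:
  fixes m m' :: "nat \<Rightarrow> 'v::finite \<Rightarrow>\<^sub>0 nat"
  assumes "s \<subseteq> {..<N}"
    and "\<And>v. \<exists>i0. \<forall>i<N. i \<noteq> i0 \<longrightarrow> Poly_Mapping.lookup (m i) v \<le> 1"
    and "\<And>v. \<exists>i0. \<forall>i<N. i \<noteq> i0 \<longrightarrow> Poly_Mapping.lookup (m' i) v \<le> 1"
    and supp: "\<And>i v. i < N \<Longrightarrow> Poly_Mapping.lookup (m i) v \<noteq> 0 \<longleftrightarrow> Poly_Mapping.lookup (m' i) v \<noteq> 0"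
    and deg: "\<And>i. i < N \<Longrightarrow> mdeg (m i) = mdeg (m' i)"
  shows "mdeg (lcm_monom m s) = mdeg (lcm_monom m' s)"
proof -
  have "{i \<in> s. Poly_Mapping.lookup (m i) v \<noteq> 0} = {i \<in> s. Poly_Mapping.lookup (m' i) v \<noteq> 0}" for v
    using supp assms(1) by blast
  moreover have "(\<Sum>i\<in>s. mdeg (m i)) = (\<Sum>i\<in>s. mdeg (m' i))"
    using deg assms(1) by (intro sum.cong) auto
  ultimately show ?thesis
    using mdeg_lcm_monom[OF assms(1,2)] mdeg_lcm_monom[OF assms(1,3)] by simp
qed

text \<open>Substituting a power of itself for each indeterminate does not change which least common multiples
coincide.\<close>

lemma lcm_monom_eq_iff_rescale:
  fixes m m' :: "nat \<Rightarrow> 'v::finite \<Rightarrow>\<^sub>0 nat"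
  assumes s: "finite s" "t \<subseteq> s"
    and m': "\<And>i v. i \<in> s \<Longrightarrow> Poly_Mapping.lookup (m' i) v = q v * Poly_Mapping.lookup (m i) v"
    and q: "\<And>v. 0 < q v"
  shows "lcm_monom m' s = lcm_monom m' t \<longleftrightarrow> lcm_monom m s = lcm_monom m t"
proof -
  have "Poly_Mapping.lookup (lcm_monom m' r) v = q v * Poly_Mapping.lookup (lcm_monom m r) v"
    if r: "r \<subseteq> s" for r v
  proof -
    have "q v * Max (insert 0 ((\<lambda>i. Poly_Mapping.lookup (m i) v) ` r))
        = Max ((*) (q v) ` insert 0 ((\<lambda>i. Poly_Mapping.lookup (m i) v) ` r))"
      using finite_subset[OF r s(1)] by (intro mono_Max_commute) (auto simp: mono_def)
    also have "(*) (q v) ` insert 0 ((\<lambda>i. Poly_Mapping.lookup (m i) v) ` r)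
        = insert 0 ((\<lambda>i. Poly_Mapping.lookup (m' i) v) ` r)"
    proof -
      have "(\<lambda>i. Poly_Mapping.lookup (m' i) v) ` r = (\<lambda>i. q v * Poly_Mapping.lookup (m i) v) ` r"
        using r m' by (intro image_cong) auto
      then show ?thesis by (simp add: image_image)
    qed
    finally show ?thesis by (simp add: lookup_lcm_monom)
  qed
  then have "Poly_Mapping.lookup (lcm_monom m' s) v = Poly_Mapping.lookup (lcm_monom m' t) v
      \<longleftrightarrow> Poly_Mapping.lookup (lcm_monom m s) v = Poly_Mapping.lookup (lcm_monom m t) v" for v
    using s q[of v] by simp
  then show ?thesis unfolding poly_mapping_eq_iff fun_eq_iff by blast
qed

section \<open>Weighted oriented cycles\<close>

definition edge_monom :: "'v wograph \<Rightarrow> 'v \<times> 'v \<Rightarrow> 'v \<Rightarrow>\<^sub>0 nat" where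
  "edge_monom D e = Poly_Mapping.single (fst e) 1 + Poly_Mapping.single (snd e) (weight D (snd e))"

lemma lookup_edge_monom:
  "fst e \<noteq> snd e \<Longrightarrow> Poly_Mapping.lookup (edge_monom D e) v
    = (if v = fst e then 1 else if v = snd e then weight D (snd e) else 0)"
  by (auto simp: edge_monom_def lookup_add lookup_single when_def)

lemma mdeg_edge_monom: "mdeg (edge_monom D e) = Suc (weight D (snd e))"
  unfolding edge_monom_def mdeg_add by (simp add: mdeg_def)

lemma edge_ideal_eq_monomial_ideal:
  assumes "edges D = e ` {..<N}"
  shows "(edge_ideal D :: ('v, 'k::comm_ring_1) mpoly set) = monomial_ideal (\<lambda>i. edge_monom D (e i)) N"
proof -
  have "var t ^ k = (Poly_Mapping.single (Poly_Mapping.single t k) 1 :: ('v, 'k) mpoly)" for t k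
    by (induction k) (auto simp: var_def mult_single single_add[symmetric])
  then have "var (fst a) * var (snd a) ^ weight D (snd a)
      = (Poly_Mapping.single (edge_monom D a) 1 :: ('v, 'k) mpoly)" for a
    by (simp add: edge_monom_def var_def mult_single)
  then have "{var s * var t ^ weight D t | s t. (s, t) \<in> edges D}
      = (\<lambda>a. Poly_Mapping.single (edge_monom D a) 1 :: ('v, 'k) mpoly) ` edges D"
    by force
  then show ?thesis by (simp add: edge_ideal_def monomial_ideal_def assms image_image)
qed

text \<open>Only the head of an edge can occur in its monomial with exponent greater than \<open>1\<close>.\<close>

lemma edge_monom_exponents:
  assumes e: "\<And>i. i < N \<Longrightarrow> fst (e i) \<noteq> snd (e i)"
    and w: "\<And>i j. i < N \<Longrightarrow> j < N \<Longrightarrow> i \<noteq> j \<Longrightarrow> snd (e i) = snd (e j) \<Longrightarrow> weight D (snd (e i)) = 1"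
  shows "\<exists>i0. \<forall>i<N. i \<noteq> i0 \<longrightarrow> Poly_Mapping.lookup (edge_monom D (e i)) v \<le> 1"
proof (cases "\<exists>i0<N. snd (e i0) = v \<and> weight D v \<noteq> 1")
  case True
  then obtain i0 where "i0 < N" "snd (e i0) = v" "weight D v \<noteq> 1" by blast
  then show ?thesis using e w by (intro exI[of _ i0]) (auto simp: lookup_edge_monom)
next
  case False
  then show ?thesis using e by (auto simp: lookup_edge_monom)
qed

context
  fixes C :: "'v::finite wograph" and x :: "int \<Rightarrow> 'v" and n :: nat
  assumes cycle: "weighted_oriented_cycle n x C"
begin

text \<open>The oriented edge of \<open>C\<close> between \<open>x i\<close> and \<open>x (i + 1)\<close>. It has the same index as the edge of the iron cycle
between these vertices, which gives the bijection between the generators of the edge ideals.\<close>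

definition cycle_edge :: "nat \<Rightarrow> 'v \<times> 'v" where
  "cycle_edge i = (if (x (int i), x (int i + 1)) \<in> edges C
     then (x (int i), x (int i + 1)) else (x (int i + 1), x (int i)))"

lemma n_ge_3: "3 \<le> n"
  using cycle by (simp add: weighted_oriented_cycle_def)

lemma x_eq_iff: "x i = x j \<longleftrightarrow> int n dvd i - j"
  using cycle by (simp add: weighted_oriented_cycle_def cong_iff_dvd_diff)

lemma x_mod: "x (i mod int n + k) = x (i + k)"
  by (simp add: x_eq_iff mod_eq_dvd_iff[symmetric] minus_mod_eq_div_mult algebra_simps)

lemma edges_asym: "(u, v) \<in> edges C \<Longrightarrow> (v, u) \<notin> edges C"
  using cycle by (auto simp: weighted_oriented_cycle_def weighted_oriented_graph_def dest: asymD)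

lemma weight_pos: "0 < weight C v"
  using cycle by (auto simp: weighted_oriented_cycle_def weighted_oriented_graph_def)

lemma x_inj:
  assumes "i < n" "j < n" "x (int i + k) = x (int j + k)"
  shows "i = j"
proof -
  have "int n dvd int i - int j" using assms(3) by (simp add: x_eq_iff)
  then have "int i mod int n = int j mod int n" by (simp add: mod_eq_dvd_iff)
  then show ?thesis using assms by simp
qed

lemma x_Suc_neq: "x i \<noteq> x (i + 1)"
  using n_ge_3 by (simp add: x_eq_iff)

lemma cycle_adjacent: "(u, v) \<in> edges C \<or> (v, u) \<in> edges C \<longleftrightarrow> (\<exists>i. {u, v} = {x i, x (i + 1)})"
  using cycle by (simp add: weighted_oriented_cycle_def)

lemma edges_eq: "edges C = cycle_edge ` {..<n}"
proof
  show "cycle_edge ` {..<n} \<subseteq> edges C"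
  proof
    fix a assume "a \<in> cycle_edge ` {..<n}"
    then obtain i where "a = cycle_edge i" by auto
    then show "a \<in> edges C" using cycle_adjacent[of "x (int i)" "x (int i + 1)"]
      by (auto simp: cycle_edge_def)
  qed
  show "edges C \<subseteq> cycle_edge ` {..<n}"
  proof (rule subrelI)
    fix u v assume uv: "(u, v) \<in> edges C"
    then obtain j where j: "{u, v} = {x j, x (j + 1)}" using cycle_adjacent by blast
    define i where "i = nat (j mod int n)"
    have i: "i < n" "int i = j mod int n" using n_ge_3 by (auto simp: i_def nat_less_iff)
    then have "x (int i) = x j" "x (int i + 1) = x (j + 1)" using x_mod[of j 0] x_mod[of j 1] by auto
    then have "cycle_edge i = (u, v)"
      using uv j edges_asym[OF uv] by (auto simp: cycle_edge_def doubleton_eq_iff)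
    then show "(u, v) \<in> cycle_edge ` {..<n}" using i by (intro image_eqI[of _ _ i]) auto
  qed
qed

lemma edges_iron_eq: "edges (iron_cycle x C) = (\<lambda>i. (x (int i), x (int i + 1))) ` {..<n}"
proof -
  have "(x j, x (j + 1)) \<in> (\<lambda>i. (x (int i), x (int i + 1))) ` {..<n}" for j
  proof (rule image_eqI)
    show "nat (j mod int n) \<in> {..<n}" using n_ge_3 by (auto simp: nat_less_iff)
    show "(x j, x (j + 1)) = (x (int (nat (j mod int n))), x (int (nat (j mod int n)) + 1))"
      using x_mod[of j 0] x_mod[of j 1] n_ge_3 by simp
  qed
  then show ?thesis unfolding edges_iron_cycle[OF cycle] by auto
qed

lemma cycle_edge_vertices: "{fst (cycle_edge i), snd (cycle_edge i)} = {x (int i), x (int i + 1)}"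
  by (auto simp: cycle_edge_def)

lemma cycle_edge_neq: "fst (cycle_edge i) \<noteq> snd (cycle_edge i)"
  using x_Suc_neq by (auto simp: cycle_edge_def dest: sym)

text \<open>A vertex of a cycle lies on only two edges. If both point to it, all its edges do.\<close>

lemma is_sink_if_two_incoming:
  assumes ij: "i < n" "j < n" "i \<noteq> j" and tgt: "snd (cycle_edge i) = v" "snd (cycle_edge j) = v"
  shows "is_sink C v"
  unfolding is_sink_def
proof (intro ballI, unfold split_paired_all, clarify)
  fix s t assume st: "(s, t) \<in> edges C" and v: "v \<in> {s, t}"
  obtain k where k: "k < n" "cycle_edge k = (s, t)" using st unfolding edges_eq by force
  have vk: "v \<in> {x (int k), x (int k + 1)}"
    using v cycle_edge_vertices[of k] k by auto
  have "v \<in> {x (int i), x (int i + 1)}" "v \<in> {x (int j), x (int j + 1)}"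
    using tgt cycle_edge_vertices[of i] cycle_edge_vertices[of j] by auto
  moreover have "x (int i) \<noteq> x (int j)" "x (int i + 1) \<noteq> x (int j + 1)"
    using x_inj[of i j 0] x_inj[of i j 1] ij by auto
  ultimately have "v = x (int i) \<and> v = x (int j + 1) \<or> v = x (int j) \<and> v = x (int i + 1)"
    by auto
  then have "k = i \<or> k = j"
    using vk x_inj[of k i 0] x_inj[of k i 1] x_inj[of k j 0] x_inj[of k j 1] ij k(1) by auto
  then show "t = v" using k(2) tgt by auto
qed

lemma weight_sink_cycle: "weight (sink_cycle C) v = (if is_sink C v then 1 else weight C v)"
  by (simp add: sink_cycle_def)

text \<open>The reversed edges of the iron cycle keep the weight of their old head, so the monomials of
corresponding edges have the same degree.\<close>

lemma weight_iron: "weight (iron_cycle x C) (x (int i + 1)) = weight (sink_cycle C) (snd (cycle_edge i))"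
proof -
  have p: "cyc_pred x (x (int i + 1)) = x (int i)" using cyc_pred_eq[OF cycle, of "int i + 1"] by simp
  have "(x (int i), x (int i + 1)) \<in> edges C \<or> (x (int i + 1), x (int i)) \<in> edges C"
    using cycle_adjacent by blast
  then show ?thesis using edges_asym
    by (auto simp: iron_cycle_def Let_def p cycle_edge_def sink_cycle_def)
qed

lemma sink_iron_mdeg_lcm:
  assumes s: "s \<subseteq> {..<n}"
  shows "mdeg (lcm_monom (\<lambda>i. edge_monom (sink_cycle C) (cycle_edge i)) s)
    = mdeg (lcm_monom (\<lambda>i. edge_monom (iron_cycle x C) (x (int i), x (int i + 1))) s)"
proof (rule mdeg_lcm_monom_eq[OF s])
  have wS: "0 < weight (sink_cycle C) v" for v by (simp add: weight_sink_cycle weight_pos)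
  show "\<exists>i0. \<forall>i<n. i \<noteq> i0 \<longrightarrow> Poly_Mapping.lookup (edge_monom (sink_cycle C) (cycle_edge i)) v \<le> 1" for v
    by (rule edge_monom_exponents)
      (use cycle_edge_neq is_sink_if_two_incoming in \<open>auto simp: weight_sink_cycle\<close>)
  show "\<exists>i0. \<forall>i<n. i \<noteq> i0 \<longrightarrow>
      Poly_Mapping.lookup (edge_monom (iron_cycle x C) (x (int i), x (int i + 1))) v \<le> 1" for v
    by (rule edge_monom_exponents) (use x_Suc_neq x_inj[of _ _ 1] in auto)
  fix i assume "i < n"
  show "mdeg (edge_monom (sink_cycle C) (cycle_edge i))
      = mdeg (edge_monom (iron_cycle x C) (x (int i), x (int i + 1)))"
    by (simp add: mdeg_edge_monom weight_iron)
  fix v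
  show "Poly_Mapping.lookup (edge_monom (sink_cycle C) (cycle_edge i)) v \<noteq> 0 \<longleftrightarrow>
      Poly_Mapping.lookup (edge_monom (iron_cycle x C) (x (int i), x (int i + 1))) v \<noteq> 0"
    using wS[of "snd (cycle_edge i)"] cycle_edge_vertices[of i] x_Suc_neq[of "int i"]
    by (auto simp: lookup_edge_monom cycle_edge_neq weight_iron)
qed

text \<open>A sink occurs in the edge ideal of \<open>C\<close> only with the exponent given by its weight, because it is never the
tail of an edge.\<close>

lemma lookup_edge_monom_rescale:
  assumes "i < n"
  shows "Poly_Mapping.lookup (edge_monom C (cycle_edge i)) v = (if is_sink C v then weight C v else 1)
    * Poly_Mapping.lookup (edge_monom (sink_cycle C) (cycle_edge i)) v"
proof -
  have "\<not> is_sink C (fst (cycle_edge i))"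
  proof
    assume "is_sink C (fst (cycle_edge i))"
    moreover have "cycle_edge i \<in> edges C" using assms edges_eq by blast
    ultimately show False using cycle_edge_neq[of i] by (auto simp: is_sink_def split_beta)
  qed
  then show ?thesis by (auto simp: lookup_edge_monom cycle_edge_neq weight_sink_cycle)
qed

end

theorem theorem4p13:
  fixes C :: "'v::finite wograph" and x :: "int \<Rightarrow> 'v" and n :: nat
  assumes "weighted_oriented_cycle n x C"
  shows "(\<forall>r d. graded_betti r d (edge_ideal (sink_cycle C) :: ('v, 'k::field) mpoly set)
             = graded_betti r d (edge_ideal (iron_cycle x C) :: ('v, 'k) mpoly set)) \<and>
         (\<forall>r. total_betti r (edge_ideal C :: ('v, 'k) mpoly set)
             = total_betti r (edge_ideal (sink_cycle C) :: ('v, 'k) mpoly set) \<and>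
           total_betti r (edge_ideal (sink_cycle C) :: ('v, 'k) mpoly set)
             = total_betti r (edge_ideal (iron_cycle x C) :: ('v, 'k) mpoly set))"
proof -
  let ?mC = "\<lambda>i. edge_monom C (cycle_edge C x i)"
    and ?mS = "\<lambda>i. edge_monom (sink_cycle C) (cycle_edge C x i)"
    and ?mI = "\<lambda>i. edge_monom (iron_cycle x C) (x (int i), x (int i + 1))"
  have C: "(edge_ideal C :: ('v, 'k) mpoly set) = monomial_ideal ?mC n"
    by (rule edge_ideal_eq_monomial_ideal[OF edges_eq[OF assms]])
  have S: "(edge_ideal (sink_cycle C) :: ('v, 'k) mpoly set) = monomial_ideal ?mS n"
    by (rule edge_ideal_eq_monomial_ideal) (simp add: sink_cycle_def edges_eq[OF assms])
  have I: "(edge_ideal (iron_cycle x C) :: ('v, 'k) mpoly set) = monomial_ideal ?mI n"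
    by (rule edge_ideal_eq_monomial_ideal[OF edges_iron_eq[OF assms]])
  have "total_betti r (monomial_ideal ?mC n :: ('v, 'k) mpoly set)
      = total_betti r (monomial_ideal ?mS n :: ('v, 'k) mpoly set)" for r
  proof (rule total_betti_monomial_ideal_eq)
    fix s t assume s: "s \<subseteq> {..<n}" and t: "t \<subseteq> s"
    show "lcm_monom ?mC s = lcm_monom ?mC t \<longleftrightarrow> lcm_monom ?mS s = lcm_monom ?mS t"
    proof (rule lcm_monom_eq_iff_rescale[OF _ t])
      show "finite s" using s finite_subset by blast
      show "Poly_Mapping.lookup (?mC i) v = (if is_sink C v then weight C v else 1) * Poly_Mapping.lookup (?mS i) v"
        if "i \<in> s" for i v using that s by (intro lookup_edge_monom_rescale[OF assms]) auto
      show "0 < (if is_sink C v then weight C v else 1)" for v using weight_pos[OF assms] by simp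
    qed
  qed
  moreover note betti_monomial_ideal_eq[OF sink_iron_mdeg_lcm[OF assms]]
  ultimately show ?thesis unfolding C S I by blast
qed

end
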